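(* Let $g:\mathbb{R}^n\to\mathbb{R}$ and $q=(q_1,\dots,q_m):\mathbb{R}^n\to\mathbb{R}^m$ be twice continuously differentiable, let $\Gamma=\{x: q_i(x)\le 0,\ i=1,\dots,m\}$, and consider the problem of minimizing $g(x)$ subject to $x\in\Gamma$. Let $\bar x\in\Gamma$ be a stationary point of this problem and let $\gamma>0$ be a real number. Suppose that MSCQ is fulfilled at $\bar x$, that $\gamma>\operatorname{subreg}Q_q(\bar x|0)$, and that the following second-order condition holds: $$\langle w,\nabla^2_{xx}L(\bar x,\lambda)w\rangle>0\quad\text{whenever } w\ne0 \text{ with } \langle\nabla q_i(\bar x),w\rangle=0,\ i\in I^+(\lambda),\ \text{and } \lambda\in\Delta(\bar x),$$ where $$\Delta(\bar x):=\Big(\bigcup_{0\ne v\in K(\bar x,-\nabla g(\bar x))}\Lambda(\bar x,-\nabla g(\bar x);v)\Big)\cap\gamma\|\nabla g(\bar x)\|\,\mathbb{B}_{\mathbb{R}^m}.$$ Then $\bar x$ is a tilt-stable local minimizer of the problem.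
   Context: Norms are Euclidean; $\mathbb{B}_r(a)$ is the closed ball of radius $r$ about $a$; $\mathbb{B}_{\mathbb{R}^m}$ is the closed unit ball of $\mathbb{R}^m$; $d(\cdot\,;\cdot)$ is the distance from a point to a set; $\mathbb{R}^m_-$ and $\mathbb{R}^m_+$ are the nonpositive and nonnegative orthants. Active indices: $I(x)=\{i:q_i(x)=0\}$ for $x\in\Gamma$; $I^+(\lambda)=\{i:\lambda_i>0\}$ for $\lambda\in\mathbb{R}^m_+$. Lagrangian: $L(x,\lambda)=g(x)+\lambda^Tq(x)$. A point $x\in\Gamma$ is stationary if there is $\lambda\in\mathbb{R}^m_+$ with $\nabla_xL(x,\lambda)=0$ and $\lambda_iq_i(x)=0$ for all $i$. Critical cone: $K(x,x^* )=T_\Gamma(x)\cap\{w:\langle x^*,w\rangle=0\}$, where $T_\Gamma(x)=\{v:\exists\,t_k\downarrow0,\ v_k\to v,\ x+t_kv_k\in\Gamma\}$ is the tangent cone. Multipliers: $\Lambda(x,x^* )=\{\lambda\in\mathbb{R}^m_+:\nabla q(x)^T\lambda=x^*,\ \lambda_i=0\text{ for }i\notin I(x)\}$. For $v\in\mathbb{R}^n$, $\Lambda(x,x^*;v)$ is the set of optimal solutions of the linear program: minimize $-v^T\nabla^2(\lambda^Tq)(x)v$ over $\lambda\in\Lambda(x,x^* )$. MSCQ (metric subregularity constraint qualification) holds at $\bar x\in\Gamma$ if there are a neighborhood $U$ of $\bar x$ and $c>0$ such that $d(x;\Gamma)\le c\,d(q(x);\mathbb{R}^m_-)$ for all $x\in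 U$. With $Q_q(x)=q(x)-\mathbb{R}^m_-$, the modulus $\operatorname{subreg}Q_q(\bar x|0)$ is the infimum of all such $c$ (over all neighborhoods $U$). Tilt stability: $\bar x\in\Gamma$ is a tilt-stable local minimizer of the problem with modulus $\kappa>0$ if there is $\gamma_0>0$ such that the mapping $v\mapsto\operatorname{argmin}\{g(x)-\langle v,x\rangle: x\in\Gamma\cap\mathbb{B}_{\gamma_0}(\bar x)\}$ is single-valued and Lipschitz continuous with constant $\kappa$ on some neighborhood of $0\in\mathbb{R}^n$, with value $\bar x$ at $v=0$. It is a tilt-stable local minimizer if this holds for some $\kappa>0$. *)

theory Defs
  imports "HOL-Analysis.Analysis"
begin

definition grad :: "('a::euclidean_space \<Rightarrow> real) \<Rightarrow> 'a \<Rightarrow> 'a" where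
  "grad f x = (THE d. GDERIV f x :> d)"

definition hess :: "(real^'n \<Rightarrow> real) \<Rightarrow> real^'n \<Rightarrow> real^'n^'n" where
  "hess f x = jacobian (grad f) (at x)"

definition twice_cont_diff :: "(real^'n \<Rightarrow> real) \<Rightarrow> bool" where
  "twice_cont_diff f \<longleftrightarrow>
     (\<forall>x. f differentiable at x) \<and> (\<forall>x. grad f differentiable at x) \<and>
     continuous_on UNIV (hess f)"

definition nonneg_orthant :: "(real^'m) set" where
  "nonneg_orthant = {y. \<forall>i. 0 \<le> y $ i}"

definition nonpos_orthant :: "(real^'m) set" where
  "nonpos_orthant = {y. \<forall>i. y $ i \<le> 0}"

definition feasible :: "(real^'n \<Rightarrow> real^'m) \<Rightarrow> (real^'n) set" where
  "feasible q = {x. \<forall>i. q x $ i \<le> 0}"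

definition active :: "(real^'n \<Rightarrow> real^'m) \<Rightarrow> real^'n \<Rightarrow> 'm set" where
  "active q x = {i. q x $ i = 0}"

definition pos_idx :: "real^'m \<Rightarrow> 'm set" where
  "pos_idx l = {i. l $ i > 0}"

definition lagrangian ::
  "(real^'n \<Rightarrow> real) \<Rightarrow> (real^'n \<Rightarrow> real^'m) \<Rightarrow> real^'n \<Rightarrow> real^'m \<Rightarrow> real" where
  "lagrangian g q x l = g x + l \<bullet> q x"

definition stationary ::
  "(real^'n \<Rightarrow> real) \<Rightarrow> (real^'n \<Rightarrow> real^'m) \<Rightarrow> real^'n \<Rightarrow> bool" where
  "stationary g q x \<longleftrightarrow> x \<in> feasible q \<and>
     (\<exists>l\<in>nonneg_orthant. grad (\<lambda>y. lagrangian g q y l) x = 0 \<and> (\<forall>i. l $ i * q x $ i = 0))"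

definition tangent_cone :: "'a::real_normed_vector set \<Rightarrow> 'a \<Rightarrow> 'a set" where
  "tangent_cone S x =
     {v. \<exists>(t :: nat \<Rightarrow> real) (u :: nat \<Rightarrow> 'a).
           (\<forall>k. 0 < t k) \<and> t \<longlonglongrightarrow> 0 \<and> u \<longlonglongrightarrow> v \<and> (\<forall>k. x + t k *\<^sub>R u k \<in> S)}"

definition critical_cone ::
  "(real^'n \<Rightarrow> real^'m) \<Rightarrow> real^'n \<Rightarrow> real^'n \<Rightarrow> (real^'n) set" where
  "critical_cone q x xs = tangent_cone (feasible q) x \<inter> {w. xs \<bullet> w = 0}"

definition multipliers ::
  "(real^'n \<Rightarrow> real^'m) \<Rightarrow> real^'n \<Rightarrow> real^'n \<Rightarrow> (real^'m) set" where
  "multipliers q x xs =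
     {l \<in> nonneg_orthant. transpose (jacobian q (at x)) *v l = xs \<and>
                           (\<forall>i. i \<notin> active q x \<longrightarrow> l $ i = 0)}"

definition dir_multipliers ::
  "(real^'n \<Rightarrow> real^'m) \<Rightarrow> real^'n \<Rightarrow> real^'n \<Rightarrow> real^'n \<Rightarrow> (real^'m) set" where
  "dir_multipliers q x xs v =
     {l. is_arg_min (\<lambda>l. - (v \<bullet> (hess (\<lambda>y. l \<bullet> q y) x *v v))) (\<lambda>l. l \<in> multipliers q x xs) l}"

definition subreg_const ::
  "(real^'n \<Rightarrow> real^'m) \<Rightarrow> real^'n \<Rightarrow> real \<Rightarrow> bool" where
  "subreg_const q x c \<longleftrightarrow> c > 0 \<and>
     (\<exists>U. open U \<and> x \<in> U \<and>
          (\<forall>y\<in>U. infdist y (feasible q) \<le> c * infdist (q y) nonpos_orthant))"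

definition MSCQ :: "(real^'n \<Rightarrow> real^'m) \<Rightarrow> real^'n \<Rightarrow> bool" where
  "MSCQ q x \<longleftrightarrow> x \<in> feasible q \<and> (\<exists>c. subreg_const q x c)"

text \<open>The infimum is taken in the extended reals, so that the modulus is infinite
  when there is no admissible constant.\<close>

definition subreg :: "(real^'n \<Rightarrow> real^'m) \<Rightarrow> real^'n \<Rightarrow> ereal" where
  "subreg q x = Inf {ereal c | c. subreg_const q x c}"

definition Delta ::
  "(real^'n \<Rightarrow> real) \<Rightarrow> (real^'n \<Rightarrow> real^'m) \<Rightarrow> real \<Rightarrow> real^'n \<Rightarrow> (real^'m) set" where
  "Delta g q \<gamma> x =
     (\<Union>v \<in> critical_cone q x (- grad g x) - {0}. dir_multipliers q x (- grad g x) v)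
     \<inter> (\<lambda>b. (\<gamma> * norm (grad g x)) *\<^sub>R b) ` cball 0 1"

definition tilt_argmin ::
  "(real^'n \<Rightarrow> real) \<Rightarrow> (real^'n) set \<Rightarrow> real^'n \<Rightarrow> real \<Rightarrow> real^'n \<Rightarrow> (real^'n) set" where
  "tilt_argmin g S xb r v =
     {x. is_arg_min (\<lambda>x. g x - v \<bullet> x) (\<lambda>x. x \<in> S \<inter> cball xb r) x}"

definition tilt_stable_with ::
  "(real^'n \<Rightarrow> real) \<Rightarrow> (real^'n) set \<Rightarrow> real^'n \<Rightarrow> real \<Rightarrow> bool" where
  "tilt_stable_with g S xb \<kappa> \<longleftrightarrow> xb \<in> S \<and> \<kappa> > 0 \<and>
     (\<exists>r>0. \<exists>V s. open V \<and> 0 \<in> V \<and> (\<forall>v\<in>V. tilt_argmin g S xb r v = {s v}) \<and>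
        \<kappa>-lipschitz_on V s \<and> s 0 = xb)"

definition tilt_stable ::
  "(real^'n \<Rightarrow> real) \<Rightarrow> (real^'n) set \<Rightarrow> real^'n \<Rightarrow> bool" where
  "tilt_stable g S xb \<longleftrightarrow> (\<exists>\<kappa>. tilt_stable_with g S xb \<kappa>)"

end

theory Submission
  imports Defs "HOL-Real_Asymp.Real_Asymp"
begin

text \<open>
  Tilt stability is proved by contradiction from two nearby minimizers of tilted problems, without
  generalised derivatives of the normal cone mapping. Three facts carry the argument.

  A minimizer \<open>u\<close> of \<open>g x - v \<bullet> x\<close> over the feasible points near \<open>xb\<close> has a multiplier of norm at most
  \<open>c * norm (grad g u - v)\<close>, where \<open>c < \<gamma>\<close> is a subregularity constant that is valid on a whole
  neighbourhood of \<open>xb\<close> (\<open>local_min_bounded_kkt\<close>).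

  If such points \<open>y k \<noteq> xb\<close> tend to \<open>xb\<close> in direction \<open>d\<close> with vanishing tilts, then \<open>d\<close> is critical and
  every limit \<open>l'\<close> of their multipliers solves the linear program belonging to \<open>d\<close>: the constraints
  with positive weight in \<open>l'\<close> are active along the sequence, so any other multiplier \<open>m\<close> has
  \<open>m \<bullet> q (y k) \<le> 0 = l' \<bullet> q (y k)\<close>, and a second-order expansion compares the objective values
  (\<open>limiting_multiplier_directional\<close>). Together with the norm bound this gives
  \<open>l' \<in> Delta g q \<gamma> xb\<close>.

  Let \<open>u1\<close> and \<open>u2\<close> be minimizers for tilts \<open>v1\<close> and \<open>v2\<close> with \<open>norm (v1 - v2) = o(norm (u1 - u2))\<close>. The
  Lagrangian with a multiplier of \<open>u2\<close> grows quadratically from \<open>u2\<close> to \<open>u1\<close>, up to the linear term of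
  the tilt, whereas minimality of \<open>u1\<close> bounds this growth by \<open>(v1 - v2) \<bullet> (u1 - u2)\<close>, which is of
  smaller order. In the limit the normalised difference \<open>w\<close> of the two points satisfies
  \<open>w \<bullet> (hess (\<lambda>x. lagrangian g q x l') xb *v w) \<le> 0\<close> and is orthogonal to the gradients of the
  constraints with positive weight in \<open>l'\<close> (\<open>two_point_second_order\<close>). This contradicts the assumed
  second-order condition, provided \<open>u2 \<noteq> xb\<close>; of two different points at least one has this property,
  and the two may be exchanged.

  Minimizers of the tilted problems exist by compactness, and they lie near \<open>xb\<close> for small tilts
  because \<open>xb\<close> is a strict local minimizer (\<open>strict_local_minimizer\<close>), which follows from the same
  facts by a quadratic penalty argument.
\<close>

section \<open>Gradients, Hessians and second-order expansions\<close>

lemma has_derivative_grad: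
  fixes f :: "'a::euclidean_space \<Rightarrow> real"
  assumes "f differentiable at x"
  shows "(f has_derivative (\<lambda>h. grad f x \<bullet> h)) (at x)"
proof -
  obtain D where D: "(f has_derivative D) (at x)"
    using assms by (auto simp: differentiable_def)
  define d where "d = adjoint D 1"
  have "D h = h \<bullet> d" for h
    using adjoint_works[OF has_derivative_linear[OF D], of h 1] by (simp add: d_def)
  then have "D = (\<lambda>h. h \<bullet> d)"
    by auto
  with D have d: "GDERIV f x :> d"
    by (simp add: gderiv_def)
  have "e = d" if "GDERIV f x :> e" for e
  proof -
    have "(\<lambda>h. h \<bullet> e) = (\<lambda>h. h \<bullet> d)"
      using that d unfolding gderiv_def by (rule has_derivative_unique)
    then show ?thesis
      by (metis vector_eq_ldot)
  qed
  with d have "grad f x = d"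
    unfolding grad_def by blast
  with d show ?thesis
    by (simp add: gderiv_def inner_commute)
qed

lemma grad_eqI:
  fixes f :: "'a::euclidean_space \<Rightarrow> real"
  assumes "(f has_derivative (\<lambda>h. d \<bullet> h)) (at x)"
  shows "grad f x = d"
proof -
  have "(\<lambda>h. grad f x \<bullet> h) = (\<lambda>h. d \<bullet> h)"
    using has_derivative_grad assms
    by (metis differentiableI has_derivative_unique)
  then show ?thesis
    by (metis vector_eq_rdot)
qed

lemma has_derivative_hess:
  assumes "grad f differentiable at x"
  shows "(grad f has_derivative (\<lambda>h. hess f x *v h)) (at x)"
  using assms jacobian_works unfolding hess_def by blast

lemma jacobian_eqI:
  fixes f :: "real^'n \<Rightarrow> real^'m"
  assumes "(f has_derivative (\<lambda>h. A *v h)) (at x)"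
  shows "jacobian f (at x) = A"
proof -
  have "(\<lambda>h. jacobian f (at x) *v h) = (\<lambda>h. A *v h)"
    using assms jacobian_works by (metis differentiableI has_derivative_unique)
  then show ?thesis
    by (metis matrix_of_matrix_vector_mul)
qed

lemma norm_matrix_vector_mult_le:
  fixes A :: "real^'n^'m"
  shows "norm (A *v x) \<le> norm A * norm x"
proof -
  have "norm (A *v x) = L2_set (\<lambda>i. \<bar>A $ i \<bullet> x\<bar>) UNIV"
    by (simp add: norm_vec_def matrix_mult_dot)
  also have "\<dots> \<le> L2_set (\<lambda>i. norm (A $ i) * norm x) UNIV"
    by (intro L2_set_mono) (auto simp: Cauchy_Schwarz_ineq2)
  also have "\<dots> = norm A * norm x"
    by (simp add: norm_vec_def[of A] L2_set_left_distrib)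
  finally show ?thesis .
qed

context
  fixes f :: "real^'n \<Rightarrow> real"
  assumes f: "twice_cont_diff f"
begin

lemma twice_cont_diff_has_derivative: "(f has_derivative (\<lambda>h. grad f x \<bullet> h)) (at x)"
  using f has_derivative_grad unfolding twice_cont_diff_def by blast

lemma twice_cont_diff_has_derivative_grad:
  "(grad f has_derivative (\<lambda>h. hess f x *v h)) (at x)"
  using f has_derivative_hess unfolding twice_cont_diff_def by blast

lemma twice_cont_diff_isCont: "isCont f x"
  using twice_cont_diff_has_derivative has_derivative_continuous by blast

lemma twice_cont_diff_isCont_grad: "isCont (grad f) x"
  using twice_cont_diff_has_derivative_grad has_derivative_continuous by blast

text \<open>Both end points of the increment may move near \<open>x\<close> while the linear map stays the Hessian at
  \<open>x\<close>: the function \<open>u \<mapsto> grad f u - hess f x *v u\<close> has a small derivative near \<open>x\<close>, by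
  continuity of the Hessian.\<close>

lemma grad_increment_uniform:
  assumes "e > 0"
  obtains d where "d > 0"
    "\<And>y z. y \<in> ball x d \<Longrightarrow> z \<in> ball x d \<Longrightarrow>
       norm (grad f z - grad f y - hess f x *v (z - y)) \<le> e * norm (z - y)"
proof -
  have "isCont (hess f) x"
    using f unfolding twice_cont_diff_def by (simp add: continuous_on_eq_continuous_at)
  then obtain d where d: "d > 0" "\<And>y. dist y x < d \<Longrightarrow> dist (hess f y) (hess f x) < e"
    using \<open>e > 0\<close> unfolding continuous_at_eps_delta by blast
  show ?thesis
  proof (rule that[OF d(1)])
    fix y z assume yz: "y \<in> ball x d" "z \<in> ball x d"
    let ?h = "\<lambda>u. grad f u - hess f x *v u"
    have der: "(?h has_derivative (\<lambda>h. hess f u *v h - hess f x *v h)) (at u within ball x d)" for u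
      by (rule has_derivative_at_withinI, rule has_derivative_diff)
         (auto intro: twice_cont_diff_has_derivative_grad bounded_linear_imp_has_derivative)
    have "norm (?h z - ?h y) \<le> e * norm (z - y)"
    proof (rule differentiable_bound[OF convex_ball der _ yz(2,1)])
      fix u assume "u \<in> ball x d"
      then have "norm (hess f u - hess f x) \<le> e"
        using d(2)[of u] by (simp add: dist_commute) (simp add: dist_norm)
      then have "norm ((hess f u - hess f x) *v h) \<le> e * norm h" for h
        using order_trans[OF norm_matrix_vector_mult_le mult_right_mono] norm_ge_zero by blast
      then show "onorm (\<lambda>h. hess f u *v h - hess f x *v h) \<le> e"
        unfolding matrix_vector_mult_diff_rdistrib by (rule onorm_le)
    qed
    then show "norm (grad f z - grad f y - hess f x *v (z - y)) \<le> e * norm (z - y)"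
      by (simp add: matrix_vector_mult_diff_distrib algebra_simps)
  qed
qed

lemma taylor_uniform:
  assumes "e > 0"
  obtains d where "d > 0"
    "\<And>y z. y \<in> ball x d \<Longrightarrow> z \<in> ball x d \<Longrightarrow>
       \<bar>f z - f y - grad f y \<bullet> (z - y) - (z - y) \<bullet> (hess f x *v (z - y)) / 2\<bar> \<le> e * (norm (z - y))\<^sup>2"
proof -
  obtain d where d: "d > 0" and inc: "\<And>y z. y \<in> ball x d \<Longrightarrow> z \<in> ball x d \<Longrightarrow>
       norm (grad f z - grad f y - hess f x *v (z - y)) \<le> e * norm (z - y)"
    using grad_increment_uniform[OF assms] by blast
  show ?thesis
  proof (rule that[OF d])
    fix y z assume yz: "y \<in> ball x d" "z \<in> ball x d"
    define h where "h = z - y"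
    define Q where "Q = h \<bullet> (hess f x *v h)"
    define p where "p t = f (y + t *\<^sub>R h) - t * (grad f y \<bullet> h) - t\<^sup>2 / 2 * Q" for t
    have "((\<lambda>t. f (y + t *\<^sub>R h)) has_derivative (\<lambda>s. grad f (y + t *\<^sub>R h) \<bullet> (s *\<^sub>R h))) (at t)" for t
      by (rule has_derivative_compose[OF _ twice_cont_diff_has_derivative])
         (auto intro!: derivative_eq_intros)
    then have "(p has_derivative
        (\<lambda>s. grad f (y + t *\<^sub>R h) \<bullet> (s *\<^sub>R h) - s * (grad f y \<bullet> h) - t * s * Q)) (at t)" for t
      unfolding p_def
      by (auto intro!: derivative_eq_intros simp: fun_eq_iff)
    then have "\<exists>t\<in>{0..1}. p 1 - p 0 = grad f (y + t *\<^sub>R h) \<bullet> ((1 - 0) *\<^sub>R h)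
        - (1 - 0) * (grad f y \<bullet> h) - t * (1 - 0) * Q"
      by (intro mvt_very_simple) (auto intro: has_derivative_at_withinI)
    then obtain t where t: "t \<in> {0..1}"
      and eq: "p 1 - p 0 = grad f (y + t *\<^sub>R h) \<bullet> h - grad f y \<bullet> h - t * Q"
      by auto
    have "y + t *\<^sub>R h \<in> ball x d"
    proof -
      have "(1 - t) *\<^sub>R y + t *\<^sub>R z \<in> ball x d"
        using convexD_alt[OF convex_ball yz(1,2), of t] t by auto
      then show ?thesis
        by (simp add: h_def algebra_simps)
    qed
    then have *: "norm (grad f (y + t *\<^sub>R h) - grad f y - hess f x *v (t *\<^sub>R h)) \<le> e * norm (t *\<^sub>R h)"
      using inc[OF yz(1), of "y + t *\<^sub>R h"] by simp
    also have "\<dots> \<le> e * norm h"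
      using t \<open>e > 0\<close> by (simp add: mult_left_le_one_le)
    finally have *: "norm (grad f (y + t *\<^sub>R h) - grad f y - hess f x *v (t *\<^sub>R h)) \<le> e * norm h" .
    have "p 1 - p 0 = (grad f (y + t *\<^sub>R h) - grad f y - hess f x *v (t *\<^sub>R h)) \<bullet> h"
      unfolding eq Q_def
      by (simp add: inner_diff_left inner_diff_right matrix_vector_mult_scaleR inner_commute)
    also have "\<bar>\<dots>\<bar> \<le> e * norm h * norm h"
      by (rule order_trans[OF Cauchy_Schwarz_ineq2 mult_right_mono[OF *]]) simp
    finally show "\<bar>f z - f y - grad f y \<bullet> (z - y) - (z - y) \<bullet> (hess f x *v (z - y)) / 2\<bar>
        \<le> e * (norm (z - y))\<^sup>2"
      by (simp add: p_def Q_def h_def power2_eq_square mult.assoc)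
  qed
qed

lemma quadratic_error_bound:
  obtains d C where "d > 0" "C \<ge> 0"
    "\<And>y. y \<in> ball x d \<Longrightarrow> \<bar>f y - f x - grad f x \<bullet> (y - x)\<bar> \<le> C * (norm (y - x))\<^sup>2"
proof -
  obtain d where d: "d > 0" and tay: "\<And>y z. y \<in> ball x d \<Longrightarrow> z \<in> ball x d \<Longrightarrow>
       \<bar>f z - f y - grad f y \<bullet> (z - y) - (z - y) \<bullet> (hess f x *v (z - y)) / 2\<bar> \<le> 1 * (norm (z - y))\<^sup>2"
    using taylor_uniform[of 1 x] by auto
  show ?thesis
  proof (rule that[of d "1 + norm (hess f x)"])
    fix y assume y: "y \<in> ball x d"
    have "\<bar>(y - x) \<bullet> (hess f x *v (y - x))\<bar> \<le> norm (y - x) * (norm (hess f x) * norm (y - x))"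
      by (rule order_trans[OF Cauchy_Schwarz_ineq2 mult_left_mono[OF norm_matrix_vector_mult_le]]) simp
    moreover have "0 \<le> norm (hess f x) * (norm (y - x))\<^sup>2"
      by simp
    moreover have "norm (y - x) * (norm (hess f x) * norm (y - x)) = norm (hess f x) * (norm (y - x))\<^sup>2"
      by (simp add: power2_eq_square)
    moreover have "\<bar>f y - f x - grad f x \<bullet> (y - x) - (y - x) \<bullet> (hess f x *v (y - x)) / 2\<bar> \<le> (norm (y - x))\<^sup>2"
      using tay[of x y] y d by simp
    ultimately show "\<bar>f y - f x - grad f x \<bullet> (y - x)\<bar> \<le> (1 + norm (hess f x)) * (norm (y - x))\<^sup>2"
      unfolding distrib_right by linarith
  qed (use d in auto)
qed

text \<open>The base point \<open>y k\<close> of the expansion is not fixed, yet the limit only involves the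
  Hessian at \<open>x\<close>. The second-order comparisons of two nearby points below rest on this.\<close>

lemma second_order_quotient_tendsto:
  assumes y: "y \<longlonglongrightarrow> x" and z: "z \<longlonglongrightarrow> x" and ne: "\<And>k. y k \<noteq> z k"
    and w: "(\<lambda>k. (z k - y k) /\<^sub>R norm (z k - y k)) \<longlonglongrightarrow> w"
  shows "(\<lambda>k::nat. (f (z k) - f (y k) - grad f (y k) \<bullet> (z k - y k)) / (norm (z k - y k))\<^sup>2)
           \<longlonglongrightarrow> (w \<bullet> (hess f x *v w)) / 2"
proof -
  define q where "q k = (f (z k) - f (y k) - grad f (y k) \<bullet> (z k - y k)) / (norm (z k - y k))\<^sup>2" for k
  define u where "u k = (z k - y k) /\<^sub>R norm (z k - y k)" for k
  have "(\<lambda>k. q k - (u k \<bullet> (hess f x *v u k)) / 2) \<longlonglongrightarrow> 0"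
  proof (rule tendstoI)
    fix e :: real assume "e > 0"
    then have "e / 2 > 0" by simp
    obtain d where d: "d > 0" and tay: "\<And>y z. y \<in> ball x d \<Longrightarrow> z \<in> ball x d \<Longrightarrow>
       \<bar>f z - f y - grad f y \<bullet> (z - y) - (z - y) \<bullet> (hess f x *v (z - y)) / 2\<bar> \<le> e / 2 * (norm (z - y))\<^sup>2"
      using taylor_uniform[OF \<open>e / 2 > 0\<close>] by blast
    have "\<forall>\<^sub>F k in sequentially. y k \<in> ball x d" "\<forall>\<^sub>F k in sequentially. z k \<in> ball x d"
      using topological_tendstoD[OF y, of "ball x d"] topological_tendstoD[OF z, of "ball x d"] d by auto
    then show "\<forall>\<^sub>F k in sequentially. dist (q k - (u k \<bullet> (hess f x *v u k)) / 2) 0 < e"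
    proof eventually_elim
      case (elim k)
      define n where "n = norm (z k - y k)"
      have n: "n > 0"
        using ne[of k] by (simp add: n_def)
      have "u k \<bullet> (hess f x *v u k) = (z k - y k) \<bullet> (hess f x *v (z k - y k)) / n\<^sup>2"
        by (simp add: u_def n_def[symmetric] matrix_vector_mult_scaleR power2_eq_square divide_inverse
            del: matrix_vector_mult_diff_distrib inner_diff_left)
      then have "q k - (u k \<bullet> (hess f x *v u k)) / 2 =
         (f (z k) - f (y k) - grad f (y k) \<bullet> (z k - y k)
            - (z k - y k) \<bullet> (hess f x *v (z k - y k)) / 2) / n\<^sup>2"
        by (simp only: q_def n_def[symmetric] diff_divide_distrib) simp
      then have "\<bar>q k - (u k \<bullet> (hess f x *v u k)) / 2\<bar> \<le> e / 2 * n\<^sup>2 / n\<^sup>2"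
        using divide_right_mono[OF tay[OF elim], of "n\<^sup>2"] by (simp add: n_def[symmetric] abs_divide)
      then show ?case
        using n \<open>e > 0\<close> by simp
    qed
  qed
  moreover have "(\<lambda>k. (u k \<bullet> (hess f x *v u k)) / 2) \<longlonglongrightarrow> (w \<bullet> (hess f x *v w)) / 2"
    using w unfolding u_def
    by (intro tendsto_intros bounded_linear.tendsto[OF matrix_vector_mul_bounded_linear]) auto
  ultimately have "(\<lambda>k. q k - (u k \<bullet> (hess f x *v u k)) / 2 + (u k \<bullet> (hess f x *v u k)) / 2)
      \<longlonglongrightarrow> 0 + (w \<bullet> (hess f x *v w)) / 2"
    by (rule tendsto_add)
  then show ?thesis
    by (simp add: q_def)
qed

lemma first_order_quotient_tendsto:
  assumes y: "y \<longlonglongrightarrow> x" and z: "z \<longlonglongrightarrow> x" and ne: "\<And>k. y k \<noteq> z k"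
    and w: "(\<lambda>k. (z k - y k) /\<^sub>R norm (z k - y k)) \<longlonglongrightarrow> w"
  shows "(\<lambda>k::nat. (f (z k) - f (y k)) / norm (z k - y k)) \<longlonglongrightarrow> grad f x \<bullet> w"
proof -
  let ?n = "\<lambda>k. norm (z k - y k)"
  let ?q = "\<lambda>k. (f (z k) - f (y k) - grad f (y k) \<bullet> (z k - y k)) / (?n k)\<^sup>2"
  have "?n \<longlonglongrightarrow> norm (x - x)"
    by (intro tendsto_intros y z)
  then have "(\<lambda>k. ?q k * ?n k + grad f (y k) \<bullet> ((z k - y k) /\<^sub>R ?n k))
      \<longlonglongrightarrow> (w \<bullet> (hess f x *v w)) / 2 * 0 + grad f x \<bullet> w"
    by (intro tendsto_add tendsto_mult tendsto_inner second_order_quotient_tendsto y z ne w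
        isCont_tendsto_compose[OF twice_cont_diff_isCont_grad]) auto
  moreover have "?q k * ?n k + grad f (y k) \<bullet> ((z k - y k) /\<^sub>R ?n k)
      = (f (z k) - f (y k)) / ?n k" for k
  proof -
    have "a / n\<^sup>2 * n = a / n" if "n \<noteq> 0" for a n :: real
      using that by (simp add: power2_eq_square)
    then have "?q k * ?n k = (f (z k) - f (y k) - grad f (y k) \<bullet> (z k - y k)) / ?n k"
      using ne[of k] by simp
    then show ?thesis
      by (simp only: inner_scaleR_right diff_divide_distrib) (simp add: divide_inverse)
  qed
  ultimately show ?thesis
    by simp
qed

end

section \<open>Bounded multipliers at local minimizers\<close>

lemma infdist_nonpos_orthant_le:
  fixes y :: "real^'m"
  shows "infdist y nonpos_orthant \<le> norm (\<chi> i. max 0 (y $ i))"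
proof -
  have "(\<chi> i. min 0 (y $ i)) \<in> nonpos_orthant"
    by (simp add: nonpos_orthant_def)
  then have "infdist y nonpos_orthant \<le> dist y (\<chi> i. min 0 (y $ i))"
    by (rule infdist_le)
  also have "y - (\<chi> i. min 0 (y $ i)) = (\<chi> i. max 0 (y $ i))"
    by (auto simp: vec_eq_iff)
  then have "dist y (\<chi> i. min 0 (y $ i)) = norm (\<chi> i. max 0 (y $ i))"
    by (simp add: dist_norm)
  finally show ?thesis .
qed

text \<open>The set of all combinations \<open>\<Sum>i\<in>UNIV. l $ i *\<^sub>R G i\<close> with admissible \<open>l\<close> is compact and convex, and
  its support function is the second term of the hypothesis. If it missed \<open>- F\<close>, a separating
  hyperplane would give a direction violating the hypothesis.\<close>

lemma bounded_multiplier_alternative: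
  fixes F :: "'a::euclidean_space" and G :: "'m::finite \<Rightarrow> 'a"
  assumes "R \<ge> 0"
    and dir: "\<And>w. 0 \<le> F \<bullet> w + R * norm ((\<chi> i. if i \<in> A then max 0 (G i \<bullet> w) else 0) :: real^'m)"
  shows "\<exists>l\<in>nonneg_orthant. (\<forall>i. i \<notin> A \<longrightarrow> l $ i = 0) \<and> norm l \<le> R \<and>
           F + (\<Sum>i\<in>UNIV. l $ i *\<^sub>R G i) = 0"
proof (rule ccontr)
  assume contr: "\<not> ?thesis"
  define T where "T l = (\<Sum>i\<in>UNIV. l $ i *\<^sub>R G i)" for l :: "real^'m"
  define K where "K = {l :: real^'m. (\<forall>i. 0 \<le> l $ i) \<and> (\<forall>i. i \<notin> A \<longrightarrow> l $ i = 0)} \<inter> cball 0 R"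
  have "linear T"
    unfolding T_def
    by (intro linearI) (auto simp: algebra_simps sum.distrib scaleR_sum_right)
  have "{l :: real^'m. (\<forall>i. 0 \<le> l $ i) \<and> (\<forall>i. i \<notin> A \<longrightarrow> l $ i = 0)}
      = (\<Inter>i. {l. 0 \<le> l $ i}) \<inter> (\<Inter>i\<in>-A. {l. l $ i = 0})"
    by auto
  also have "closed \<dots>"
    by (intro closed_Int closed_INT ballI closed_Collect_le closed_Collect_eq
        continuous_on_const continuous_on_component continuous_on_id)
  finally have "closed {l :: real^'m. (\<forall>i. 0 \<le> l $ i) \<and> (\<forall>i. i \<notin> A \<longrightarrow> l $ i = 0)}" .
  then have "compact K"
    unfolding K_def by (intro closed_Int_compact) auto
  then have "closed (T ` K)"
    by (intro compact_imp_closed compact_continuous_image linear_continuous_on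
        linear_linear[THEN iffD2] \<open>linear T\<close>)
  moreover have "convex K"
    unfolding K_def by (intro convex_Int convex_cball) (auto simp: convex_def)
  then have "convex (T ` K)"
    by (rule convex_linear_image[OF \<open>linear T\<close>])
  moreover have "- F \<notin> T ` K"
  proof
    assume "- F \<in> T ` K"
    then obtain l where l: "l \<in> K" "- F = T l"
      by blast
    then have "F + T l = 0"
      by (simp flip: l(2))
    with contr l(1) show False
      by (auto simp: K_def T_def nonneg_orthant_def)
  qed
  ultimately obtain a b where ab: "a \<bullet> (- F) < b" "\<And>x. x \<in> T ` K \<Longrightarrow> a \<bullet> x > b"
    using separating_hyperplane_closed_point[of "T ` K" "- F"] by auto
  define p :: "real^'m" where "p = (\<chi> i. if i \<in> A then max 0 (G i \<bullet> (- a)) else 0)"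
  \<comment> \<open>The minimizer of \<open>a \<bullet> T l\<close> over \<open>K\<close>, by the equality case of the Cauchy--Schwarz inequality;
     for \<open>p = 0\<close> the division by zero makes it \<open>0\<close>.\<close>
  define l where "l = (R / norm p) *\<^sub>R p"
  have "l \<in> K"
    using \<open>R \<ge> 0\<close> by (cases "p = 0") (auto simp: K_def l_def p_def)
  then have "a \<bullet> T l > b"
    using ab(2) by blast
  moreover have "a \<bullet> T l = - (R * norm p)"
  proof -
    have "a \<bullet> T l = (\<Sum>i\<in>UNIV. - (l $ i * p $ i))"
      unfolding T_def inner_sum_right
      by (intro sum.cong refl) (auto simp: l_def p_def inner_commute max_def)
    also have "\<dots> = - (l \<bullet> p)"
      by (simp add: inner_vec_def sum_negf)
    also have "l \<bullet> p = R * norm p"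
      by (simp add: l_def power2_norm_eq_inner[symmetric] power2_eq_square)
    finally show ?thesis .
  qed
  moreover have "0 \<le> F \<bullet> (- a) + R * norm p"
    using dir[of "- a"] unfolding p_def .
  ultimately show False
    using ab(1) by (simp add: inner_commute)
qed

text \<open>Exact penalisation: move from \<open>u\<close> to \<open>u + t *\<^sub>R w\<close> and then back to a nearest feasible point \<open>p\<close>.
  Subregularity bounds the length of the way back by \<open>c\<close> times the constraint violation, which is
  \<open>t\<close> times the norm on the right up to \<open>o(t)\<close>; the way back costs at most \<open>norm F\<close> per unit of
  length, and \<open>f p \<ge> f u\<close>.\<close>

lemma local_min_directional:
  fixes f :: "real^'n \<Rightarrow> real" and q :: "real^'n \<Rightarrow> real^'m"
  assumes f: "(f has_derivative (\<lambda>h. F \<bullet> h)) (at u)"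
    and q: "\<And>i. ((\<lambda>x. q x $ i) has_derivative (\<lambda>h. G i \<bullet> h)) (at u)"
    and "closed (feasible q)" and u: "u \<in> feasible q" and W: "open W" "u \<in> W" and "c \<ge> 0"
    and subreg: "\<And>y. y \<in> W \<Longrightarrow> infdist y (feasible q) \<le> c * infdist (q y) nonpos_orthant"
    and min: "\<And>p. p \<in> feasible q \<Longrightarrow> p \<in> W \<Longrightarrow> f u \<le> f p"
  shows "0 \<le> F \<bullet> w + c * norm F *
           norm ((\<chi> i. if i \<in> active q u then max 0 (G i \<bullet> w) else 0) :: real^'m)"
    (is "0 \<le> _ + _ * norm ?a")
proof -
  define t where "t k = inverse (real (Suc k))" for k
  have t: "t k > 0" for k
    by (simp add: t_def)
  have t0: "t \<longlonglongrightarrow> 0"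
    unfolding t_def by (rule LIMSEQ_inverse_real_of_nat)
  define y where "y k = u + t k *\<^sub>R w" for k
  have y: "y \<longlonglongrightarrow> u"
    unfolding y_def using tendsto_add[OF tendsto_const tendsto_scaleR[OF t0 tendsto_const], of u w] by simp
  have "\<exists>p\<in>feasible q. infdist (y k) (feasible q) = dist (y k) p" for k
    using infdist_attains_inf[OF \<open>closed (feasible q)\<close>, of "y k"] u by blast
  then obtain p where p: "\<And>k. p k \<in> feasible q" "\<And>k. infdist (y k) (feasible q) = dist (y k) (p k)"
    by metis
  define b where "b k = (\<chi> i. max 0 (q (y k) $ i / t k))" for k
  have b: "b \<longlonglongrightarrow> ?a"
  proof (rule vec_tendstoI)
    fix i
    have "((\<lambda>s. q (u + s *\<^sub>R w) $ i) has_derivative (\<lambda>s. G i \<bullet> (s *\<^sub>R w))) (at 0)"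
    proof (rule has_derivative_compose[where g = "\<lambda>x. q x $ i"])
      show "((\<lambda>s. u + s *\<^sub>R w) has_derivative (\<lambda>s. s *\<^sub>R w)) (at 0)"
        by (auto intro!: derivative_eq_intros)
      show "((\<lambda>x. q x $ i) has_derivative (\<lambda>h. G i \<bullet> h)) (at (u + 0 *\<^sub>R w))"
        using q[of i] by simp
    qed
    then have "((\<lambda>s. q (u + s *\<^sub>R w) $ i) has_field_derivative G i \<bullet> w) (at 0)"
      by (simp add: has_field_derivative_def mult.commute[of _ "G i \<bullet> w"])
    then have lim: "((\<lambda>s. (q (u + s *\<^sub>R w) $ i - q u $ i) / s) \<longlongrightarrow> G i \<bullet> w) (at 0)"
      by (simp add: has_field_derivative_iff)
    have t0': "filterlim t (at 0) sequentially"
      using t0 t less_imp_neq[OF t] by (auto simp: filterlim_at)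
    have dq: "(\<lambda>k. (q (y k) $ i - q u $ i) / t k) \<longlonglongrightarrow> G i \<bullet> w"
      using filterlim_compose[OF lim t0'] by (simp add: y_def)
    show "(\<lambda>k. b k $ i) \<longlonglongrightarrow> ?a $ i"
    proof (cases "i \<in> active q u")
      case True
      then have "(\<lambda>k. max 0 ((q (y k) $ i - q u $ i) / t k)) \<longlonglongrightarrow> max 0 (G i \<bullet> w)"
        by (intro tendsto_max tendsto_const dq)
      with True show ?thesis
        by (simp add: b_def active_def)
    next
      case False
      with u have neg: "q u $ i < 0"
        by (auto simp: feasible_def active_def less_le)
      have "(\<lambda>k. q (y k) $ i) \<longlonglongrightarrow> q u $ i"
        using has_derivative_continuous[OF q[of i]] y by (rule isCont_tendsto_compose)
      then have "\<forall>\<^sub>F k in sequentially. q (y k) $ i < 0"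
        using neg by (rule order_tendstoD)
      then have "\<forall>\<^sub>F k in sequentially. b k $ i = ?a $ i"
      proof eventually_elim
        case (elim k)
        then have "q (y k) $ i / t k \<le> 0"
          using t[of k] by (simp add: divide_nonpos_pos)
        with False show ?case
          by (simp add: b_def)
      qed
      then show ?thesis
        by (rule tendsto_eventually)
    qed
  qed
  have close: "\<forall>\<^sub>F k in sequentially. dist (y k) (p k) \<le> t k * (c * norm (b k))"
    using topological_tendstoD[OF y W]
  proof eventually_elim
    case (elim k)
    have "(\<chi> i. max 0 (q (y k) $ i)) = t k *\<^sub>R b k"
      using t[of k] by (simp add: b_def vec_eq_iff max_mult_distrib_left)
    then have "infdist (q (y k)) nonpos_orthant \<le> t k * norm (b k)"
      using infdist_nonpos_orthant_le[of "q (y k)"] t[of k] by simp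
    then have "c * infdist (q (y k)) nonpos_orthant \<le> c * (t k * norm (b k))"
      using \<open>c \<ge> 0\<close> by (rule mult_left_mono)
    with subreg[OF elim] show ?case
      by (simp add: p(2) mult_ac)
  qed
  have "(\<lambda>k. t k * (c * norm (b k))) \<longlonglongrightarrow> 0 * (c * norm ?a)"
    by (intro tendsto_intros t0 b)
  then have "(\<lambda>k. dist (y k) (p k)) \<longlonglongrightarrow> 0"
    using close by (intro tendsto_sandwich[OF _ close tendsto_const]) auto
  then have pu: "p \<longlonglongrightarrow> u"
    using Lim_transform[OF y, of p] by (simp add: dist_norm tendsto_norm_zero_iff norm_minus_commute)
  have "0 \<le> F \<bullet> w + c * norm F * norm ?a + e * (norm w + c * norm ?a)" if "e > 0" for e
  proof -
    obtain d where d: "d > 0"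
      "\<And>x. norm (x - u) < d \<Longrightarrow> norm (f x - f u - F \<bullet> (x - u)) \<le> e * norm (x - u)"
      using f \<open>e > 0\<close> unfolding has_derivative_at_alt by blast
    have ev: "\<forall>\<^sub>F k in sequentially. p k \<in> W" "\<forall>\<^sub>F k in sequentially. dist (p k) u < d"
      using topological_tendstoD[OF pu W] tendstoD[OF pu d(1)] by auto
    have "\<forall>\<^sub>F k in sequentially. 0 \<le> F \<bullet> w + c * norm F * norm (b k) + e * (norm w + c * norm (b k))"
      using ev close
    proof eventually_elim
      case (elim k)
      have pyu: "p k - u = t k *\<^sub>R w - (y k - p k)"
        by (simp add: y_def)
      have "norm (p k - u) \<le> t k * norm w + t k * (c * norm (b k))"
        using norm_triangle_ineq4[of "t k *\<^sub>R w" "y k - p k"] elim(3) t[of k]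
        unfolding pyu by (simp add: dist_norm)
      then have 1: "e * norm (p k - u) \<le> e * (t k * norm w + t k * (c * norm (b k)))"
        using \<open>e > 0\<close> by simp
      have "- (F \<bullet> (y k - p k)) \<le> norm F * norm (y k - p k)"
        using Cauchy_Schwarz_ineq2[of F "y k - p k"] by linarith
      also have "\<dots> \<le> norm F * (t k * (c * norm (b k)))"
        using elim(3) by (intro mult_left_mono) (auto simp: dist_norm)
      finally have 2: "F \<bullet> (p k - u) \<le> t k * (F \<bullet> w) + norm F * (t k * (c * norm (b k)))"
        unfolding pyu inner_diff_right inner_scaleR_right by simp
      have "f u \<le> f (p k)"
        using min p(1) elim(1) by blast
      moreover have "norm (f (p k) - f u - F \<bullet> (p k - u)) \<le> e * norm (p k - u)"
        using d(2) elim(2) by (simp add: dist_norm)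
      ultimately have "0 \<le> F \<bullet> (p k - u) + e * norm (p k - u)"
        by simp
      with 1 2 have "0 \<le> t k * (F \<bullet> w + c * norm F * norm (b k) + e * (norm w + c * norm (b k)))"
        by (simp add: algebra_simps)
      with t[of k] show ?case
        by (simp add: zero_le_mult_iff)
    qed
    moreover have "(\<lambda>k. F \<bullet> w + c * norm F * norm (b k) + e * (norm w + c * norm (b k)))
        \<longlonglongrightarrow> F \<bullet> w + c * norm F * norm ?a + e * (norm w + c * norm ?a)"
      by (intro tendsto_intros b)
    ultimately show ?thesis
      by (intro tendsto_lowerbound) auto
  qed
  then have lb: "\<forall>\<^sub>F e in at_right 0. 0 \<le> F \<bullet> w + c * norm F * norm ?a + e * (norm w + c * norm ?a)"
    by (auto simp: eventually_at_filter)
  have lim: "((\<lambda>e. F \<bullet> w + c * norm F * norm ?a + e * (norm w + c * norm ?a))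
      \<longlongrightarrow> F \<bullet> w + c * norm F * norm ?a + 0 * (norm w + c * norm ?a)) (at_right 0)"
    by (intro tendsto_intros)
  show ?thesis
    using tendsto_lowerbound[OF lim lb] by simp
qed

text \<open>The first-order system of the tilted objective \<open>g x - v \<bullet> x\<close>. Since \<open>v\<close> is a parameter, solutions
  for varying tilts can be passed to the limit.\<close>

definition kkt ::
  "(real^'n \<Rightarrow> real) \<Rightarrow> (real^'n \<Rightarrow> real^'m) \<Rightarrow> real^'n \<Rightarrow> real^'n \<Rightarrow> real^'m \<Rightarrow> bool" where
  "kkt g q v x l \<longleftrightarrow> x \<in> feasible q \<and> l \<in> nonneg_orthant \<and> (\<forall>i. l $ i * q x $ i = 0) \<and>
     grad g x + (\<Sum>i\<in>UNIV. l $ i *\<^sub>R grad (\<lambda>x. q x $ i) x) = v"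

lemma closed_feasible:
  fixes q :: "real^'n \<Rightarrow> real^'m"
  assumes "\<And>i. twice_cont_diff (\<lambda>x. q x $ i)"
  shows "closed (feasible q)"
  unfolding feasible_def
  by (intro closed_Collect_all closed_Collect_le continuous_on_const)
     (use assms twice_cont_diff_isCont in \<open>auto simp: continuous_on_eq_continuous_at\<close>)

text \<open>The constant in the bound is the subregularity constant itself. This is what places limits of these
  multipliers in the ball of radius \<open>\<gamma> * norm (grad g xb)\<close> that occurs in \<open>Delta\<close>.\<close>

lemma local_min_bounded_kkt:
  fixes g :: "real^'n \<Rightarrow> real" and q :: "real^'n \<Rightarrow> real^'m"
  assumes q: "\<And>i. twice_cont_diff (\<lambda>x. q x $ i)"
    and f: "(f has_derivative (\<lambda>h. (grad g u - v) \<bullet> h)) (at u)"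
    and u: "u \<in> feasible q" and W: "open W" "u \<in> W" and "c \<ge> 0"
    and subreg: "\<And>y. y \<in> W \<Longrightarrow> infdist y (feasible q) \<le> c * infdist (q y) nonpos_orthant"
    and min: "\<And>p. p \<in> feasible q \<Longrightarrow> p \<in> W \<Longrightarrow> f u \<le> f p"
  shows "\<exists>l. kkt g q v u l \<and> norm l \<le> c * norm (grad g u - v)"
proof -
  have "\<exists>l\<in>nonneg_orthant. (\<forall>i. i \<notin> active q u \<longrightarrow> l $ i = 0) \<and> norm l \<le> c * norm (grad g u - v) \<and>
      grad g u - v + (\<Sum>i\<in>UNIV. l $ i *\<^sub>R grad (\<lambda>x. q x $ i) u) = 0"
    using local_min_directional[OF f twice_cont_diff_has_derivative[OF q] closed_feasible[OF q] u W
        \<open>c \<ge> 0\<close> subreg min] \<open>c \<ge> 0\<close>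
    by (intro bounded_multiplier_alternative) auto
  then show ?thesis
    using u unfolding kkt_def active_def by (auto simp: algebra_simps)
qed

section \<open>The Lagrangian and the multiplier set\<close>

lemma sum_scaleR_matrix_vector_mult:
  fixes A :: "real^'n^'k" and B :: "'m::finite \<Rightarrow> real^'n^'k" and l :: "real^'m"
  shows "(A + (\<Sum>i\<in>UNIV. l $ i *\<^sub>R B i)) *v h = A *v h + (\<Sum>i\<in>UNIV. l $ i *\<^sub>R (B i *v h))"
proof -
  have lin: "linear (\<lambda>M :: real^'n^'k. M *v h)"
    by (intro linearI) (simp_all add: matrix_vector_mult_add_rdistrib scaleR_matrix_vector_assoc)
  have "(\<Sum>i\<in>UNIV. l $ i *\<^sub>R B i) *v h = (\<Sum>i\<in>UNIV. (l $ i *\<^sub>R B i) *v h)"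
    by (rule linear_sum[OF lin])
  also have "\<dots> = (\<Sum>i\<in>UNIV. l $ i *\<^sub>R (B i *v h))"
    by (intro sum.cong refl linear_scale[OF lin])
  finally show ?thesis
    by (simp only: matrix_vector_mult_add_rdistrib)
qed

context
  fixes g :: "real^'n \<Rightarrow> real" and q :: "real^'n \<Rightarrow> real^'m"
  assumes g: "twice_cont_diff g" and q: "\<And>i. twice_cont_diff (\<lambda>x. q x $ i)"
begin

lemma has_derivative_lagrangian:
  "((\<lambda>y. lagrangian g q y l) has_derivative
     (\<lambda>h. (grad g x + (\<Sum>i\<in>UNIV. l $ i *\<^sub>R grad (\<lambda>x. q x $ i) x)) \<bullet> h)) (at x)"
proof -
  have "((\<lambda>y. g y + (\<Sum>i\<in>UNIV. l $ i * q y $ i)) has_derivative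
      (\<lambda>h. grad g x \<bullet> h + (\<Sum>i\<in>UNIV. l $ i * (grad (\<lambda>x. q x $ i) x \<bullet> h)))) (at x)"
    by (intro has_derivative_add has_derivative_sum has_derivative_mult_right
        twice_cont_diff_has_derivative g q)
  then show ?thesis
    by (simp add: lagrangian_def inner_vec_def[of l] inner_add_left inner_sum_left)
qed

lemma grad_lagrangian:
  "grad (\<lambda>y. lagrangian g q y l) = (\<lambda>x. grad g x + (\<Sum>i\<in>UNIV. l $ i *\<^sub>R grad (\<lambda>x. q x $ i) x))"
  by (rule ext grad_eqI has_derivative_lagrangian)+

lemma has_derivative_grad_lagrangian:
  "(grad (\<lambda>y. lagrangian g q y l) has_derivative
     (\<lambda>h. (hess g x + (\<Sum>i\<in>UNIV. l $ i *\<^sub>R hess (\<lambda>x. q x $ i) x)) *v h)) (at x)"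
  unfolding grad_lagrangian sum_scaleR_matrix_vector_mult
  by (intro has_derivative_add has_derivative_sum has_derivative_scaleR_right
      twice_cont_diff_has_derivative_grad g q)

lemma hess_lagrangian:
  "hess (\<lambda>y. lagrangian g q y l) = (\<lambda>x. hess g x + (\<Sum>i\<in>UNIV. l $ i *\<^sub>R hess (\<lambda>x. q x $ i) x))"
  unfolding hess_def[of "\<lambda>y. lagrangian g q y l"]
  by (rule ext jacobian_eqI has_derivative_grad_lagrangian)+

lemma twice_cont_diff_lagrangian: "twice_cont_diff (\<lambda>y. lagrangian g q y l)"
  unfolding twice_cont_diff_def
proof (intro conjI allI)
  show "grad (\<lambda>y. lagrangian g q y l) differentiable at x" for x
    using has_derivative_grad_lagrangian by (auto simp: differentiable_def)
  show "continuous_on UNIV (hess (\<lambda>y. lagrangian g q y l))"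
    unfolding hess_lagrangian
    by (intro continuous_intros) (use g q in \<open>auto simp: twice_cont_diff_def\<close>)
qed (rule differentiableI[OF has_derivative_lagrangian])

lemma hess_lagrangian_quadratic:
  "w \<bullet> (hess (\<lambda>y. lagrangian g q y l) x *v w) =
     w \<bullet> (hess g x *v w) + (\<Sum>i\<in>UNIV. l $ i * (w \<bullet> (hess (\<lambda>x. q x $ i) x *v w)))"
  by (simp add: hess_lagrangian sum_scaleR_matrix_vector_mult inner_add_right inner_sum_right)

end

text \<open>The function \<open>l \<bullet> q y\<close> is the Lagrangian of the zero objective.\<close>

lemma hess_inner_quadratic:
  fixes q :: "real^'n \<Rightarrow> real^'m"
  assumes "\<And>i. twice_cont_diff (\<lambda>x. q x $ i)"
  shows "w \<bullet> (hess (\<lambda>y. l \<bullet> q y) x *v w) =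
           (\<Sum>i\<in>UNIV. l $ i * (w \<bullet> (hess (\<lambda>x. q x $ i) x *v w)))"
proof -
  have grad0: "grad (\<lambda>_ :: real^'n. 0 :: real) = (\<lambda>_. 0)"
    by (rule ext) (auto intro: grad_eqI)
  have hess0: "hess (\<lambda>_ :: real^'n. 0 :: real) = (\<lambda>_. 0)"
    unfolding hess_def grad0 by (rule ext) (auto intro: jacobian_eqI)
  have "twice_cont_diff (\<lambda>_ :: real^'n. 0 :: real)"
    by (simp add: twice_cont_diff_def grad0 hess0)
  from hess_lagrangian_quadratic[OF this assms] show ?thesis
    by (simp add: lagrangian_def hess0)
qed

lemma transpose_jacobian_mult:
  fixes q :: "real^'n \<Rightarrow> real^'m"
  assumes q: "\<And>i. twice_cont_diff (\<lambda>x. q x $ i)"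
  shows "transpose (jacobian q (at x)) *v l = (\<Sum>i\<in>UNIV. l $ i *\<^sub>R grad (\<lambda>x. q x $ i) x)"
proof -
  let ?A = "(\<chi> i. grad (\<lambda>x. q x $ i) x) :: real^'n^'m"
  have "(q has_derivative (\<lambda>h. ?A *v h)) (at x)"
    unfolding has_derivative_componentwise_within[of q]
    using twice_cont_diff_has_derivative[OF q]
    by (auto simp: Basis_vec_def inner_axis matrix_mult_dot)
  then have "jacobian q (at x) = ?A"
    by (rule jacobian_eqI)
  then show ?thesis
    by (simp add: vec_eq_iff matrix_vector_mult_def transpose_def mult.commute)
qed

lemma multipliers_iff_kkt:
  assumes "\<And>i. twice_cont_diff (\<lambda>x. q x $ i)" and "x \<in> feasible q"
  shows "l \<in> multipliers q x (- grad g x) \<longleftrightarrow> kkt g q 0 x l"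
  using assms(2) transpose_jacobian_mult[OF assms(1)]
  by (auto simp: multipliers_def kkt_def active_def eq_neg_iff_add_eq_0 add.commute)

lemma kkt_limit:
  fixes g :: "real^'n \<Rightarrow> real" and q :: "real^'n \<Rightarrow> real^'m"
  assumes g: "twice_cont_diff g" and q: "\<And>i. twice_cont_diff (\<lambda>x. q x $ i)"
    and kkt: "\<And>k. kkt g q (v k) (y k) (l k)"
    and y: "y \<longlonglongrightarrow> x" and v: "v \<longlonglongrightarrow> v'" and l: "l \<longlonglongrightarrow> l'"
  shows "kkt g q v' x l'"
  unfolding kkt_def
proof (intro conjI allI)
  show "x \<in> feasible q"
    using closed_feasible[OF q] y kkt by (auto simp: closed_sequential_limits kkt_def)
  have li: "(\<lambda>k. l k $ i) \<longlonglongrightarrow> l' $ i" for i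
    by (intro tendsto_intros l)
  have "0 \<le> l' $ i" for i
    using li kkt by (intro tendsto_lowerbound[OF li]) (auto simp: kkt_def nonneg_orthant_def)
  then show "l' \<in> nonneg_orthant"
    by (simp add: nonneg_orthant_def)
  show "l' $ i * q x $ i = 0" for i
  proof -
    have "(\<lambda>k. l k $ i * q (y k) $ i) \<longlonglongrightarrow> l' $ i * q x $ i"
      by (intro tendsto_mult li isCont_tendsto_compose[OF twice_cont_diff_isCont[OF q] y])
    moreover have "l k $ i * q (y k) $ i = 0" for k
      using kkt[of k] by (simp add: kkt_def)
    ultimately show ?thesis
      by (simp only: LIMSEQ_const_iff)
  qed
  have "(\<lambda>k. grad g (y k) + (\<Sum>i\<in>UNIV. l k $ i *\<^sub>R grad (\<lambda>x. q x $ i) (y k)))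
      \<longlonglongrightarrow> grad g x + (\<Sum>i\<in>UNIV. l' $ i *\<^sub>R grad (\<lambda>x. q x $ i) x)"
    by (intro tendsto_add tendsto_sum tendsto_scaleR li
        isCont_tendsto_compose[OF twice_cont_diff_isCont_grad y] g q)
  then have "v \<longlonglongrightarrow> grad g x + (\<Sum>i\<in>UNIV. l' $ i *\<^sub>R grad (\<lambda>x. q x $ i) x)"
    using kkt by (simp add: kkt_def)
  then show "grad g x + (\<Sum>i\<in>UNIV. l' $ i *\<^sub>R grad (\<lambda>x. q x $ i) x) = v'"
    using v LIMSEQ_unique by blast
qed

section \<open>Limits of multipliers and two-point comparison\<close>

text \<open>If \<open>l' $ i > 0\<close>, the \<open>i\<close>-th constraint is active at \<open>x\<close> and at almost all \<open>y k\<close>, so its gradient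
  annihilates \<open>d\<close>; hence \<open>d\<close> is critical. For optimality of \<open>l'\<close> in the linear program of \<open>d\<close>, let
  \<open>m\<close> be any multiplier at \<open>x\<close>. Then \<open>m \<bullet> q (y k) \<le> 0 = l' \<bullet> q (y k)\<close>, and in the expansion of
  \<open>(m - l') \<bullet> q\<close> at \<open>x\<close> the terms of order zero and one vanish, which leaves
  \<open>d \<bullet> (hess (\<lambda>y. (m - l') \<bullet> q y) x *v d) \<le> 0\<close>.\<close>

lemma limiting_multiplier_directional:
  fixes g :: "real^'n \<Rightarrow> real" and q :: "real^'n \<Rightarrow> real^'m"
  assumes g: "twice_cont_diff g" and q: "\<And>i. twice_cont_diff (\<lambda>x. q x $ i)"
    and kkt: "\<And>k. kkt g q (v k) (y k) (l k)"
    and y: "y \<longlonglongrightarrow> x" and v: "v \<longlonglongrightarrow> 0" and l: "l \<longlonglongrightarrow> l'"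
    and ne: "\<And>k. y k \<noteq> x" and d: "(\<lambda>k. (y k - x) /\<^sub>R norm (y k - x)) \<longlonglongrightarrow> d"
  shows "d \<in> critical_cone q x (- grad g x) - {0}"
    and "l' \<in> dir_multipliers q x (- grad g x) d"
proof -
  let ?G = "\<lambda>i. grad (\<lambda>x. q x $ i) x" and ?H = "\<lambda>i. hess (\<lambda>x. q x $ i) x"
  have kkt': "kkt g q 0 x l'"
    by (rule kkt_limit[OF g q kkt y v l])
  then have x: "x \<in> feasible q" and nonneg: "\<And>i. 0 \<le> l' $ i"
    by (auto simp: kkt_def nonneg_orthant_def)
  have act: "\<forall>\<^sub>F k in sequentially. q (y k) $ i = 0" if "l' $ i > 0" for i
  proof -
    have "(\<lambda>k. l k $ i) \<longlonglongrightarrow> l' $ i"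
      by (intro tendsto_intros l)
    then have "\<forall>\<^sub>F k in sequentially. l k $ i > 0"
      using that by (rule order_tendstoD)
    then show ?thesis
      using kkt by (auto simp: kkt_def elim!: eventually_mono) (metis less_irrefl mult_eq_0_iff)
  qed
  have quot: "(\<lambda>k. (q (y k) $ i - q x $ i) / norm (y k - x)) \<longlonglongrightarrow> ?G i \<bullet> d" for i
    by (rule first_order_quotient_tendsto[OF q tendsto_const y not_sym[OF ne] d])
  have orth: "l' $ i * (?G i \<bullet> d) = 0" for i
  proof (cases "l' $ i > 0")
    case True
    then have "q x $ i = 0"
      using kkt' by (auto simp: kkt_def) (metis less_irrefl mult_eq_0_iff)
    then have "\<forall>\<^sub>F k in sequentially. (q (y k) $ i - q x $ i) / norm (y k - x) = 0"
      using act[OF True] by (auto elim: eventually_mono)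
    then have "?G i \<bullet> d = 0"
      by (rule LIMSEQ_unique[OF quot tendsto_eventually])
    then show ?thesis by simp
  next
    case False
    with nonneg[of i] show ?thesis by simp
  qed
  have "(\<lambda>k. norm ((y k - x) /\<^sub>R norm (y k - x))) \<longlonglongrightarrow> norm d"
    by (rule tendsto_norm[OF d])
  then have "norm d = 1"
    using ne by (simp add: LIMSEQ_const_iff)
  moreover have "d \<in> tangent_cone (feasible q) x"
  proof -
    have "(\<lambda>k. norm (y k - x)) \<longlonglongrightarrow> 0"
      using y by (simp add: LIM_zero_iff tendsto_norm_zero_iff)
    then show ?thesis
      unfolding tangent_cone_def
      using d ne kkt
      by (auto simp: kkt_def intro!: exI[of _ "\<lambda>k. norm (y k - x)"]
          exI[of _ "\<lambda>k. (y k - x) /\<^sub>R norm (y k - x)"])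
  qed
  moreover have "- grad g x \<bullet> d = (\<Sum>i\<in>UNIV. l' $ i * (?G i \<bullet> d))"
  proof -
    have "grad g x + (\<Sum>i\<in>UNIV. l' $ i *\<^sub>R ?G i) = 0"
      using kkt' by (simp add: kkt_def)
    then have "- grad g x = (\<Sum>i\<in>UNIV. l' $ i *\<^sub>R ?G i)"
      by (rule minus_unique)
    then show ?thesis
      by (simp add: inner_sum_left)
  qed
  ultimately show "d \<in> critical_cone q x (- grad g x) - {0}"
    using orth by (auto simp: critical_cone_def)
  have "(\<Sum>i\<in>UNIV. m $ i * (d \<bullet> (?H i *v d))) \<le> (\<Sum>i\<in>UNIV. l' $ i * (d \<bullet> (?H i *v d)))"
    if m: "kkt g q 0 x m" for m
  proof -
    let ?r = "\<lambda>k i. (q (y k) $ i - q x $ i - ?G i \<bullet> (y k - x)) / (norm (y k - x))\<^sup>2"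
    have lim: "(\<lambda>k. \<Sum>i\<in>UNIV. (m $ i - l' $ i) * ?r k i)
        \<longlonglongrightarrow> (\<Sum>i\<in>UNIV. (m $ i - l' $ i) * ((d \<bullet> (?H i *v d)) / 2))"
      by (intro tendsto_sum tendsto_mult tendsto_const
          second_order_quotient_tendsto[OF q tendsto_const y not_sym[OF ne] d])
    have "\<forall>\<^sub>F k in sequentially. \<forall>i. l' $ i > 0 \<longrightarrow> q (y k) $ i = 0"
      using act by (intro eventually_all_finite) (auto intro: eventually_mono)
    then have "\<forall>\<^sub>F k in sequentially. (\<Sum>i\<in>UNIV. (m $ i - l' $ i) * ?r k i) \<le> 0"
    proof eventually_elim
      case (elim k)
      have "grad g x + (\<Sum>i\<in>UNIV. m $ i *\<^sub>R ?G i) = 0" "grad g x + (\<Sum>i\<in>UNIV. l' $ i *\<^sub>R ?G i) = 0"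
        using m kkt' by (simp_all add: kkt_def)
      from this[THEN minus_unique] have sumG: "(\<Sum>i\<in>UNIV. (m $ i - l' $ i) *\<^sub>R ?G i) = 0"
        by (simp add: scaleR_left_diff_distrib sum_subtractf)
      have "(\<Sum>i\<in>UNIV. (m $ i - l' $ i) * (?G i \<bullet> (y k - x)))
          = (\<Sum>i\<in>UNIV. (m $ i - l' $ i) *\<^sub>R ?G i) \<bullet> (y k - x)"
        by (simp add: inner_sum_left)
      then have lin: "(\<Sum>i\<in>UNIV. (m $ i - l' $ i) * (?G i \<bullet> (y k - x))) = 0"
        by (simp add: sumG)
      have "(m $ i - l' $ i) * (q (y k) $ i - q x $ i) \<le> 0" for i
      proof -
        have "m $ i * q x $ i = 0" "l' $ i * q x $ i = 0" "0 \<le> m $ i" "q (y k) $ i \<le> 0"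
          using m kkt' kkt[of k] by (auto simp: kkt_def nonneg_orthant_def feasible_def)
        moreover have "l' $ i * q (y k) $ i = 0"
          using elim nonneg[of i] by (metis less_le mult_eq_0_iff)
        ultimately have "(m $ i - l' $ i) * (q (y k) $ i - q x $ i) = m $ i * q (y k) $ i"
          by (simp only: left_diff_distrib right_diff_distrib)
        with \<open>0 \<le> m $ i\<close> \<open>q (y k) $ i \<le> 0\<close> show ?thesis
          by (simp add: mult_nonneg_nonpos)
      qed
      then have "(\<Sum>i\<in>UNIV. (m $ i - l' $ i) * (q (y k) $ i - q x $ i)) \<le> 0"
        by (intro sum_nonpos) auto
      moreover have "(\<Sum>i\<in>UNIV. (m $ i - l' $ i) * ?r k i) =
          ((\<Sum>i\<in>UNIV. (m $ i - l' $ i) * (q (y k) $ i - q x $ i))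
           - (\<Sum>i\<in>UNIV. (m $ i - l' $ i) * (?G i \<bullet> (y k - x)))) / (norm (y k - x))\<^sup>2"
        by (simp add: sum_divide_distrib right_diff_distrib flip: sum_subtractf)
      ultimately show ?case
        by (simp add: lin divide_nonpos_nonneg)
    qed
    then have "(\<Sum>i\<in>UNIV. (m $ i - l' $ i) * ((d \<bullet> (?H i *v d)) / 2)) \<le> 0"
      using tendsto_upperbound[OF lim] by simp
    moreover have "(\<Sum>i\<in>UNIV. (m $ i - l' $ i) * ((d \<bullet> (?H i *v d)) / 2)) =
        ((\<Sum>i\<in>UNIV. m $ i * (d \<bullet> (?H i *v d))) - (\<Sum>i\<in>UNIV. l' $ i * (d \<bullet> (?H i *v d)))) / 2"
      by (simp add: sum_divide_distrib left_diff_distrib diff_divide_distrib flip: sum_subtractf)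
    ultimately show ?thesis
      by simp
  qed
  then show "l' \<in> dir_multipliers q x (- grad g x) d"
    unfolding dir_multipliers_def is_arg_min_def multipliers_iff_kkt[OF q x] hess_inner_quadratic[OF q]
    using kkt' by (auto simp: not_less)
qed

text \<open>Expand the Lagrangian with the multiplier of \<open>y k\<close> at \<open>y k\<close>. The multiplier term is \<open>0\<close> at \<open>y k\<close> and
  nonpositive at \<open>z k\<close>. If \<open>z k\<close> has tilted value not larger than that of \<open>y k\<close>, up to an error of
  second order, then the quadratic term in the direction of \<open>z k - y k\<close> cannot be positive, and the
  multiplier term at \<open>z k\<close> must be of second order. The latter makes \<open>w\<close> orthogonal to the gradients
  of the constraints with positive limiting multiplier.\<close>

lemma two_point_second_order:
  fixes g :: "real^'n \<Rightarrow> real" and q :: "real^'n \<Rightarrow> real^'m"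
  assumes g: "twice_cont_diff g" and q: "\<And>i. twice_cont_diff (\<lambda>x. q x $ i)"
    and kkt: "\<And>k. kkt g q (v k) (y k) (l k)" and z: "\<And>k. z k \<in> feasible q"
    and y: "y \<longlonglongrightarrow> x" and zx: "z \<longlonglongrightarrow> x" and l: "l \<longlonglongrightarrow> l'"
    and ne: "\<And>k. y k \<noteq> z k" and w: "(\<lambda>k. (z k - y k) /\<^sub>R norm (z k - y k)) \<longlonglongrightarrow> w"
    and e: "e \<longlonglongrightarrow> 0"
    and le: "\<And>k. g (z k) - g (y k) - v k \<bullet> (z k - y k) \<le> e k * (norm (z k - y k))\<^sup>2"
  shows "w \<bullet> (hess (\<lambda>y. lagrangian g q y l') x *v w) \<le> 0"
    and "\<And>i. i \<in> pos_idx l' \<Longrightarrow> grad (\<lambda>x. q x $ i) x \<bullet> w = 0"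
proof -
  let ?n = "\<lambda>k. norm (z k - y k)"
  let ?rg = "\<lambda>k. (g (z k) - g (y k) - grad g (y k) \<bullet> (z k - y k)) / (?n k)\<^sup>2"
  let ?rq = "\<lambda>i k. (q (z k) $ i - q (y k) $ i - grad (\<lambda>x. q x $ i) (y k) \<bullet> (z k - y k)) / (?n k)\<^sup>2"
  define S where "S k = ?rg k + (\<Sum>i\<in>UNIV. l k $ i * ?rq i k)" for k
  have li: "(\<lambda>k. l k $ i) \<longlonglongrightarrow> l' $ i" for i
    by (intro tendsto_intros l)
  have "S \<longlonglongrightarrow> (w \<bullet> (hess g x *v w)) / 2 +
      (\<Sum>i\<in>UNIV. l' $ i * ((w \<bullet> (hess (\<lambda>x. q x $ i) x *v w)) / 2))"
    unfolding S_def
    by (intro tendsto_add tendsto_sum tendsto_mult li second_order_quotient_tendsto g q y zx ne w)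
  also have "(w \<bullet> (hess g x *v w)) / 2 +
      (\<Sum>i\<in>UNIV. l' $ i * ((w \<bullet> (hess (\<lambda>x. q x $ i) x *v w)) / 2))
      = (w \<bullet> (hess (\<lambda>y. lagrangian g q y l') x *v w)) / 2"
    by (simp add: hess_lagrangian_quadratic[OF g q] add_divide_distrib sum_divide_distrib)
  finally have S: "S \<longlonglongrightarrow> (w \<bullet> (hess (\<lambda>y. lagrangian g q y l') x *v w)) / 2" .
  have lz: "l k $ i * q (z k) $ i \<le> 0" for k i
    using kkt[of k] z[of k] by (auto simp: kkt_def nonneg_orthant_def feasible_def mult_nonneg_nonpos)
  have ly: "l k $ i * q (y k) $ i = 0" for k i
    using kkt[of k] by (simp add: kkt_def)
  have npos: "?n k > 0" for k
    using ne[of k] by simp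
  have S_le: "S k \<le> e k + (\<Sum>i\<in>UNIV. l k $ i * q (z k) $ i) / (?n k)\<^sup>2" for k
  proof -
    let ?D = "z k - y k" and ?G = "\<lambda>i. grad (\<lambda>x. q x $ i) (y k)"
    have v: "v k = grad g (y k) + (\<Sum>i\<in>UNIV. l k $ i *\<^sub>R ?G i)"
      using kkt[of k] by (simp add: kkt_def)
    have "S k = (g (z k) - g (y k) - grad g (y k) \<bullet> ?D
        + (\<Sum>i\<in>UNIV. l k $ i * (q (z k) $ i - q (y k) $ i - ?G i \<bullet> ?D))) / (?n k)\<^sup>2"
      by (simp add: S_def add_divide_distrib sum_divide_distrib)
    also have "(\<Sum>i\<in>UNIV. l k $ i * (q (z k) $ i - q (y k) $ i - ?G i \<bullet> ?D))
        = (\<Sum>i\<in>UNIV. l k $ i * q (z k) $ i) - (\<Sum>i\<in>UNIV. l k $ i * (?G i \<bullet> ?D))"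
      by (simp add: right_diff_distrib ly sum_subtractf)
    also have "(\<Sum>i\<in>UNIV. l k $ i * (?G i \<bullet> ?D)) = (v k - grad g (y k)) \<bullet> ?D"
      by (simp add: v inner_sum_left)
    finally have "S k = (g (z k) - g (y k) - v k \<bullet> ?D) / (?n k)\<^sup>2
        + (\<Sum>i\<in>UNIV. l k $ i * q (z k) $ i) / (?n k)\<^sup>2"
      by (simp add: inner_diff_left[of "v k"] flip: add_divide_distrib)
    moreover have "(g (z k) - g (y k) - v k \<bullet> ?D) / (?n k)\<^sup>2 \<le> e k"
      using le[of k] npos[of k] by (simp add: pos_divide_le_eq)
    ultimately show ?thesis by simp
  qed
  have "S k \<le> e k" for k
  proof -
    have "(\<Sum>i\<in>UNIV. l k $ i * q (z k) $ i) / (?n k)\<^sup>2 \<le> 0"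
      by (intro divide_nonpos_nonneg sum_nonpos) (auto simp: lz)
    with S_le[of k] show ?thesis by linarith
  qed
  then have "(w \<bullet> (hess (\<lambda>y. lagrangian g q y l') x *v w)) / 2 \<le> 0"
    by (intro LIMSEQ_le[OF S e]) auto
  then show "w \<bullet> (hess (\<lambda>y. lagrangian g q y l') x *v w) \<le> 0"
    by simp
  fix i
  assume i: "i \<in> pos_idx l'"
  let ?G = "grad (\<lambda>x. q x $ i) x"
  have "(\<lambda>k. l k $ i * ((q (z k) $ i - q (y k) $ i) / ?n k)) \<longlonglongrightarrow> l' $ i * (?G \<bullet> w)"
    by (intro tendsto_mult li first_order_quotient_tendsto[OF q y zx ne w])
  moreover have "l k $ i * ((q (z k) $ i - q (y k) $ i) / ?n k) = l k $ i * q (z k) $ i / ?n k" for k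
    by (simp only: times_divide_eq_right right_diff_distrib ly diff_0_right)
  ultimately have lim: "(\<lambda>k. l k $ i * q (z k) $ i / ?n k) \<longlonglongrightarrow> l' $ i * (?G \<bullet> w)"
    by (simp only:)
  have "l' $ i * (?G \<bullet> w) \<le> 0"
    using npos by (intro LIMSEQ_le[OF lim tendsto_const]) (auto simp: lz divide_nonpos_pos)
  moreover have "0 \<le> l' $ i * (?G \<bullet> w)"
  proof -
    have "?n \<longlonglongrightarrow> norm (x - x)"
      by (intro tendsto_intros zx y)
    then have "(\<lambda>k. ?n k * (S k - e k))
        \<longlonglongrightarrow> norm (x - x) * ((w \<bullet> (hess (\<lambda>y. lagrangian g q y l') x *v w)) / 2 - 0)"
      by (intro tendsto_mult tendsto_diff S e)
    then have lim0: "(\<lambda>k. ?n k * (S k - e k)) \<longlonglongrightarrow> 0"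
      by simp
    have "?n k * (S k - e k) \<le> l k $ i * q (z k) $ i / ?n k" for k
    proof -
      have "(\<Sum>i\<in>UNIV. l k $ i * q (z k) $ i) \<le> l k $ i * q (z k) $ i"
        using sum_nonpos[of "UNIV - {i}" "\<lambda>i. l k $ i * q (z k) $ i"] lz
        by (simp add: sum.remove[of UNIV i])
      then have "S k - e k \<le> l k $ i * q (z k) $ i / (?n k)\<^sup>2"
        using S_le[of k] divide_right_mono[of _ _ "(?n k)\<^sup>2"] by fastforce
      then have "?n k * (S k - e k) \<le> ?n k * (l k $ i * q (z k) $ i / (?n k)\<^sup>2)"
        using npos[of k] by (intro mult_left_mono) auto
      then show ?thesis
        using ne[of k] by (simp add: power2_eq_square split: if_splits)
    qed
    then show ?thesis
      by (intro LIMSEQ_le[OF lim0 lim]) auto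
  qed
  ultimately have "l' $ i * (?G \<bullet> w) = 0"
    by linarith
  with i show "?G \<bullet> w = 0"
    by (simp add: pos_idx_def)
qed

section \<open>Tilt stability from the second-order condition\<close>

lemma joint_convergent_subsequence:
  fixes a :: "nat \<Rightarrow> 'a::euclidean_space" and b :: "nat \<Rightarrow> 'b::euclidean_space"
    and c :: "nat \<Rightarrow> 'c::euclidean_space"
  assumes "bounded (range a)" "bounded (range b)" "bounded (range c)"
  obtains r a' b' c' where "strict_mono (r :: nat \<Rightarrow> nat)"
    "(\<lambda>k. a (r k)) \<longlonglongrightarrow> a'" "(\<lambda>k. b (r k)) \<longlonglongrightarrow> b'" "(\<lambda>k. c (r k)) \<longlonglongrightarrow> c'"
proof -
  let ?f = "\<lambda>k. (a k, b k, c k)"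
  have "bounded (range ?f)"
    by (rule bounded_subset[OF bounded_Times[OF assms(1) bounded_Times[OF assms(2,3)]]]) auto
  then obtain L r where r: "strict_mono r" and lim: "(?f \<circ> r) \<longlonglongrightarrow> L"
    using bounded_imp_convergent_subsequence by blast
  show ?thesis
    using that[OF r] tendsto_fst[OF lim] tendsto_fst[OF tendsto_snd[OF lim]]
      tendsto_snd[OF tendsto_snd[OF lim]] by (simp add: o_def)
qed

lemma bounded_range_normalised:
  fixes a :: "nat \<Rightarrow> 'a::real_normed_vector"
  shows "bounded (range (\<lambda>k. a k /\<^sub>R norm (a k)))"
proof (rule boundedI[of _ 1])
  show "norm x \<le> 1" if "x \<in> range (\<lambda>k. a k /\<^sub>R norm (a k))" for x
    using that by (auto simp: divide_inverse[symmetric] mult.commute)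
qed

context
  fixes g :: "real^'n \<Rightarrow> real" and q :: "real^'n \<Rightarrow> real^'m" and xb :: "real^'n"
    and \<gamma> c \<rho> :: real
  assumes g: "twice_cont_diff g" and q: "\<And>i. twice_cont_diff (\<lambda>x. q x $ i)"
    and c: "0 \<le> c" "c \<le> \<gamma>"
    and subreg: "\<And>y. y \<in> ball xb \<rho> \<Longrightarrow> infdist y (feasible q) \<le> c * infdist (q y) nonpos_orthant"
    and soc: "\<And>w l. w \<noteq> 0 \<Longrightarrow> l \<in> Delta g q \<gamma> xb \<Longrightarrow>
           (\<And>i. i \<in> pos_idx l \<Longrightarrow> grad (\<lambda>x. q x $ i) xb \<bullet> w = 0) \<Longrightarrow>
           w \<bullet> (hess (\<lambda>x. lagrangian g q x l) xb *v w) > 0"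
begin

text \<open>The points \<open>z k\<close> are arbitrary companions of the points \<open>y k\<close>. Their relative direction is extracted
  along the same subsequence because the second-order condition will be applied to it.\<close>

lemma kkt_subsequence:
  assumes kkt: "\<And>k. kkt g q (v k) (y k) (l k)"
    and bound: "\<And>k. norm (l k) \<le> c * norm (grad g (y k) - v k)"
    and y: "y \<longlonglongrightarrow> xb" and v: "v \<longlonglongrightarrow> 0" and ne: "\<And>k. y k \<noteq> xb" and z: "\<And>k. z k \<noteq> y k"
  obtains r l' w where "strict_mono (r :: nat \<Rightarrow> nat)" "(\<lambda>k. l (r k)) \<longlonglongrightarrow> l'"
    "(\<lambda>k. (z (r k) - y (r k)) /\<^sub>R norm (z (r k) - y (r k))) \<longlonglongrightarrow> w" "w \<noteq> 0"
    "kkt g q 0 xb l'" "l' \<in> Delta g q \<gamma> xb"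
proof -
  have lim: "(\<lambda>k. c * norm (grad g (y k) - v k)) \<longlonglongrightarrow> c * norm (grad g xb - 0)"
    by (intro tendsto_intros isCont_tendsto_compose[OF twice_cont_diff_isCont_grad[OF g] y] v)
  then have "bounded (range (\<lambda>k. c * norm (grad g (y k) - v k)))"
    by (rule convergent_imp_bounded)
  then obtain B where "\<And>k. \<bar>c * norm (grad g (y k) - v k)\<bar> \<le> B"
    unfolding bounded_iff by auto
  then have "bounded (range l)"
    using bound by (intro boundedI[of _ B]) (auto intro: order_trans[OF _ order_trans[OF abs_ge_self]])
  then obtain r l' d w where r: "strict_mono (r :: nat \<Rightarrow> nat)" and l': "(\<lambda>k. l (r k)) \<longlonglongrightarrow> l'"
    and d: "(\<lambda>k. (y (r k) - xb) /\<^sub>R norm (y (r k) - xb)) \<longlonglongrightarrow> d"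
    and w: "(\<lambda>k. (z (r k) - y (r k)) /\<^sub>R norm (z (r k) - y (r k))) \<longlonglongrightarrow> w"
    using joint_convergent_subsequence[OF _ bounded_range_normalised bounded_range_normalised,
        of l "\<lambda>k. y k - xb" "\<lambda>k. z k - y k"] by blast
  have yr: "(\<lambda>k. y (r k)) \<longlonglongrightarrow> xb" and vr: "(\<lambda>k. v (r k)) \<longlonglongrightarrow> 0"
    using LIMSEQ_subseq_LIMSEQ[OF y r] LIMSEQ_subseq_LIMSEQ[OF v r] by (simp_all add: o_def)
  note dir = limiting_multiplier_directional[OF g q kkt yr vr l' ne d]
  have "norm l' \<le> c * norm (grad g xb - 0)"
    by (rule LIMSEQ_le[OF tendsto_norm[OF l'] LIMSEQ_subseq_LIMSEQ[OF lim r]]) (simp add: o_def bound)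
  also have "\<dots> \<le> \<gamma> * norm (grad g xb)"
    using c by (simp add: mult_right_mono)
  finally have norm: "norm l' \<le> \<gamma> * norm (grad g xb)" .
  have "l' \<in> (\<lambda>b. (\<gamma> * norm (grad g xb)) *\<^sub>R b) ` cball 0 1"
  proof (cases "\<gamma> * norm (grad g xb) = 0")
    case True
    with norm show ?thesis by (auto intro!: image_eqI[of _ _ 0])
  next
    case False
    with c have "\<gamma> * norm (grad g xb) > 0"
      by (auto simp: less_le)
    with norm show ?thesis
      by (intro image_eqI[of _ _ "l' /\<^sub>R (\<gamma> * norm (grad g xb))"])
         (auto simp: field_simps)
  qed
  with dir have "l' \<in> Delta g q \<gamma> xb"
    unfolding Delta_def by blast
  moreover have "norm w = 1"
    using tendsto_norm[OF w] z by (simp add: LIMSEQ_const_iff)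
  then have "w \<noteq> 0"
    by auto
  moreover have "kkt g q 0 xb l'"
    by (rule kkt_limit[OF g q kkt yr vr l'])
  ultimately show ?thesis
    using that[OF r l' w] by blast
qed

text \<open>Suppose that there are feasible \<open>u k \<noteq> xb\<close> tending to \<open>xb\<close> with \<open>g (u k) \<le> g xb\<close>. They need not satisfy
  any first-order condition, so they are replaced by minimizers \<open>y k\<close> of
  \<open>g x + M * (norm (x - u k))\<^sup>2\<close> over the feasible points near \<open>xb\<close>. Stationarity of \<open>xb\<close> gives
  \<open>g x \<ge> g xb - C * (norm (x - xb))\<^sup>2\<close> there; with \<open>M\<close> much larger than \<open>C\<close> this forces \<open>y k\<close>
  to be at least twice as close to \<open>u k\<close> as to \<open>xb\<close>, hence different from \<open>xb\<close> and convergent to it.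
  The gradient of the quadratic term acts as a vanishing tilt, and \<open>g (y k) \<le> g xb\<close> contradicts the
  second-order condition for a limiting multiplier of the \<open>y k\<close>.\<close>

lemma strict_local_minimizer:
  assumes "\<rho> > 0" and kkt0: "kkt g q 0 xb l0"
  obtains r where "0 < r" "r \<le> \<rho>"
    "\<And>x. x \<in> feasible q \<Longrightarrow> x \<in> cball xb r \<Longrightarrow> x \<noteq> xb \<Longrightarrow> g xb < g x"
proof (rule ccontr)
  assume contr: "\<not> thesis"
  have xb: "xb \<in> feasible q"
    using kkt0 by (simp add: kkt_def)
  let ?L = "\<lambda>x. lagrangian g q x l0"
  obtain d C where d: "d > 0" and C: "C \<ge> 0" and
    bd: "\<And>y. y \<in> ball xb d \<Longrightarrow> \<bar>?L y - ?L xb - grad ?L xb \<bullet> (y - xb)\<bar> \<le> C * (norm (y - xb))\<^sup>2"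
    using quadratic_error_bound[OF twice_cont_diff_lagrangian[OF g q, of l0], of xb] by blast
  have grow: "g xb \<le> g y + C * (norm (y - xb))\<^sup>2" if "y \<in> ball xb d" "y \<in> feasible q" for y
  proof -
    have "grad ?L xb = 0"
      using kkt0 by (simp add: grad_lagrangian[OF g q] kkt_def)
    moreover have "?L xb = g xb"
      using kkt0 by (auto simp: lagrangian_def inner_vec_def kkt_def intro!: sum.neutral)
    moreover have "?L y \<le> g y"
      using kkt0 that(2) by (auto simp: lagrangian_def inner_vec_def kkt_def nonneg_orthant_def
          feasible_def mult_nonneg_nonpos intro!: sum_nonpos)
    ultimately show ?thesis
      using bd[OF that(1)] by auto
  qed
  define r where "r = min d \<rho> / 2"
  have r: "r > 0" "r < d" "r < \<rho>"
    using d \<open>\<rho> > 0\<close> by (auto simp: r_def)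
  define s where "s k = r / (4 * real (Suc k))" for k
  have s: "0 < s k" "2 * s k < r" for k
    using r by (auto simp: s_def field_simps intro!: add_pos_nonneg)
  have "\<exists>x. x \<in> feasible q \<and> x \<in> cball xb (s k) \<and> x \<noteq> xb \<and> g x \<le> g xb" for k
    using contr that[of "s k"] s[of k] r by (force simp: not_less)
  then obtain u where u: "\<And>k. u k \<in> feasible q" "\<And>k. dist xb (u k) \<le> s k" "\<And>k. u k \<noteq> xb"
    "\<And>k. g (u k) \<le> g xb"
    by (metis mem_cball)
  \<comment> \<open>The factor \<open>4\<close> becomes the factor \<open>2\<close> between the two distances after taking roots.\<close>
  define M where "M = 4 * (C + 1)"
  define f where "f k x = g x + M * ((x - u k) \<bullet> (x - u k))" for k x
  have contf: "continuous_on A (f k)" for A k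
    unfolding f_def using twice_cont_diff_isCont[OF g]
    by (intro continuous_intros continuous_at_imp_continuous_on) auto
  have "compact (feasible q \<inter> cball xb r)"
    by (intro closed_Int_compact closed_feasible q compact_cball)
  moreover have "xb \<in> feasible q \<inter> cball xb r"
    using xb r by auto
  ultimately have "\<exists>y\<in>feasible q \<inter> cball xb r. \<forall>p\<in>feasible q \<inter> cball xb r. f k y \<le> f k p" for k
    by (intro continuous_attains_inf contf) auto
  then obtain y where y: "\<And>k. y k \<in> feasible q" "\<And>k. y k \<in> cball xb r"
    and ymin: "\<And>k p. p \<in> feasible q \<Longrightarrow> p \<in> cball xb r \<Longrightarrow> f k (y k) \<le> f k p"
    by (metis IntI IntD1 IntD2)
  have fy: "g (y k) + M * (norm (y k - u k))\<^sup>2 \<le> g (u k)" for k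
  proof -
    have "u k \<in> cball xb r"
      using u(2)[of k] s[of k] by simp
    then show ?thesis
      using ymin[OF u(1)[of k], of k] by (simp add: f_def power2_norm_eq_inner)
  qed
  have half: "2 * norm (y k - u k) \<le> norm (y k - xb)" for k
  proof -
    have "y k \<in> ball xb d"
      using y(2)[of k] r by auto
    then have "M * (norm (y k - u k))\<^sup>2 \<le> C * (norm (y k - xb))\<^sup>2"
      using grow[OF _ y(1)] fy[of k] u(4)[of k] by fastforce
    also have "\<dots> \<le> (C + 1) * (norm (y k - xb))\<^sup>2"
      by (simp add: mult_right_mono)
    finally have "(C + 1) * (2 * norm (y k - u k))\<^sup>2 \<le> (C + 1) * (norm (y k - xb))\<^sup>2"
      by (simp add: M_def power2_eq_square algebra_simps)
    then have "(2 * norm (y k - u k))\<^sup>2 \<le> (norm (y k - xb))\<^sup>2"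
      using C by simp
    then show ?thesis
      by (rule power2_le_imp_le) simp
  qed
  have ne: "y k \<noteq> xb" for k
    using half[of k] u(3)[of k] by auto
  have near: "norm (y k - xb) \<le> 2 * s k" for k
    using half[of k] norm_triangle_ineq[of "y k - u k" "u k - xb"] u(2)[of k]
    by (simp add: dist_norm norm_minus_commute)
  have "s \<longlonglongrightarrow> 0"
    unfolding s_def by real_asymp
  then have s0: "(\<lambda>k. 2 * s k) \<longlonglongrightarrow> 0"
    by (rule tendsto_mult_right_zero)
  have yxb: "y \<longlonglongrightarrow> xb"
    by (rule LIM_zero_cancel, rule Lim_null_comparison[OF always_eventually s0]) (use near in blast)
  define v where "v k = - (2 * M) *\<^sub>R (y k - u k)" for k
  have "norm (y k - u k) \<le> 2 * s k" for k
    using half[of k] near[of k] norm_ge_zero[of "y k - u k"] by linarith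
  then have "(\<lambda>k. y k - u k) \<longlonglongrightarrow> 0"
    by (intro Lim_null_comparison[OF always_eventually s0] allI)
  then have "(\<lambda>k. - (2 * M) *\<^sub>R (y k - u k)) \<longlonglongrightarrow> - (2 * M) *\<^sub>R 0"
    by (intro tendsto_scaleR tendsto_const)
  then have v0: "v \<longlonglongrightarrow> 0"
    by (simp add: v_def[abs_def])
  have "\<exists>l. kkt g q (v k) (y k) l \<and> norm l \<le> c * norm (grad g (y k) - v k)" for k
  proof (rule local_min_bounded_kkt[OF q, where W = "ball xb r" and f = "f k"])
    show "(f k has_derivative (\<lambda>h. (grad g (y k) - v k) \<bullet> h)) (at (y k))"
      unfolding f_def v_def
      by (auto intro!: derivative_eq_intros twice_cont_diff_has_derivative[OF g]
          simp: fun_eq_iff inner_diff_left inner_commute algebra_simps)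
    show "y k \<in> ball xb r"
      using near[of k] s(2)[of k] by (simp add: dist_norm norm_minus_commute)
  qed (use c r y ymin subreg in auto)
  then obtain l where kkt: "\<And>k. kkt g q (v k) (y k) (l k)"
    and bound: "\<And>k. norm (l k) \<le> c * norm (grad g (y k) - v k)"
    by metis
  obtain \<sigma> l' w where \<sigma>: "strict_mono \<sigma>" and
    w: "(\<lambda>k. (xb - y (\<sigma> k)) /\<^sub>R norm (xb - y (\<sigma> k))) \<longlonglongrightarrow> w" "w \<noteq> 0"
    and l': "kkt g q 0 xb l'" "l' \<in> Delta g q \<gamma> xb"
    by (rule kkt_subsequence[OF kkt bound yxb v0 ne, of "\<lambda>_. xb"]) (rule not_sym[OF ne])
  have w': "(\<lambda>k. (y (\<sigma> k) - xb) /\<^sub>R norm (y (\<sigma> k) - xb)) \<longlonglongrightarrow> - w"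
  proof -
    have "(y (\<sigma> k) - xb) /\<^sub>R norm (y (\<sigma> k) - xb) = - ((xb - y (\<sigma> k)) /\<^sub>R norm (xb - y (\<sigma> k)))" for k
      unfolding norm_minus_commute[of xb] scaleR_minus_right[symmetric] minus_diff_eq ..
    then show ?thesis
      using tendsto_minus[OF w(1)] by (simp only:)
  qed
  have y\<sigma>: "(\<lambda>k. y (\<sigma> k)) \<longlonglongrightarrow> xb"
    using LIMSEQ_subseq_LIMSEQ[OF yxb \<sigma>] by (simp add: o_def)
  have le: "g (y (\<sigma> k)) - g xb - 0 \<bullet> (y (\<sigma> k) - xb) \<le> 0 * (norm (y (\<sigma> k) - xb))\<^sup>2" for k
  proof -
    have "0 \<le> M * (norm (y (\<sigma> k) - u (\<sigma> k)))\<^sup>2"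
      using C by (simp add: M_def)
    then show ?thesis
      using fy[of "\<sigma> k"] u(4)[of "\<sigma> k"] by simp
  qed
  \<comment> \<open>Here the base point is constantly \<open>xb\<close>, with the limiting multiplier and tilt \<open>0\<close>.\<close>
  note tp = two_point_second_order[OF g q l'(1) y(1) tendsto_const y\<sigma> tendsto_const not_sym[OF ne] w' tendsto_const le]
  have "- w \<bullet> (hess (\<lambda>x. lagrangian g q x l') xb *v - w) > 0"
    using w(2) l'(2) tp(2) by (intro soc) auto
  with tp(1) show False
    by simp
qed

lemma tilt_argmin_near:
  assumes "0 < r" and xb: "xb \<in> feasible q"
    and strict: "\<And>x. x \<in> feasible q \<Longrightarrow> x \<in> cball xb r \<Longrightarrow> x \<noteq> xb \<Longrightarrow> g xb < g x"
    and "0 < e"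
  obtains \<delta> where "0 < \<delta>"
    "\<And>v u. norm v < \<delta> \<Longrightarrow> u \<in> tilt_argmin g (feasible q) xb r v \<Longrightarrow> dist xb u < e"
proof -
  let ?S = "feasible q \<inter> cball xb r - ball xb e"
  have "compact ?S"
    by (intro compact_diff closed_Int_compact closed_feasible q compact_cball open_ball)
  have contg: "continuous_on ?S g"
    using twice_cont_diff_isCont[OF g] by (intro continuous_at_imp_continuous_on) auto
  obtain m where m: "g xb < m" "\<And>x. x \<in> ?S \<Longrightarrow> m \<le> g x"
  proof (cases "?S = {}")
    case True
    then show ?thesis
      by (intro that[of "g xb + 1"]) (simp, blast)
  next
    case False
    then obtain x where "x \<in> ?S" "\<And>y. y \<in> ?S \<Longrightarrow> g x \<le> g y"
      using continuous_attains_inf[OF \<open>compact ?S\<close> False contg] by blast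
    then show ?thesis
    proof (intro that[of "g x"])
      have "x \<noteq> xb"
        using \<open>x \<in> ?S\<close> \<open>0 < e\<close> by auto
      with \<open>x \<in> ?S\<close> show "g xb < g x"
        by (intro strict) auto
    qed
  qed
  show ?thesis
  proof (rule that[of "(m - g xb) / r"])
    show "0 < (m - g xb) / r"
      using m(1) \<open>0 < r\<close> by simp
    fix v u
    assume v: "norm v < (m - g xb) / r" and u: "u \<in> tilt_argmin g (feasible q) xb r v"
    then have uS: "u \<in> feasible q" "dist xb u \<le> r" and "g u - v \<bullet> u \<le> g xb - v \<bullet> xb"
      using xb \<open>0 < r\<close> by (auto simp: tilt_argmin_def is_arg_min_linorder)
    then have "g u - g xb \<le> v \<bullet> (u - xb)"
      by (simp add: inner_diff_right)
    also have "\<dots> \<le> norm v * norm (u - xb)"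
      by (rule norm_cauchy_schwarz)
    also have "\<dots> \<le> norm v * r"
      using uS(2) by (intro mult_left_mono) (auto simp: dist_norm norm_minus_commute)
    also have "\<dots> < m - g xb"
      using v \<open>0 < r\<close> by (simp add: field_simps)
    finally show "dist xb u < e"
      using m(2)[of u] uS by force
  qed
qed

text \<open>Single-valuedness is the case \<open>v1 = v2\<close>. If no Lipschitz constant works, there are minimizers
  \<open>u1 k \<noteq> u2 k\<close> tending to \<open>xb\<close> whose tilts differ by \<open>o(norm (u1 k - u2 k))\<close>. Minimality of \<open>u1 k\<close> then
  supplies the hypothesis of the two-point comparison with base points \<open>u2 k\<close>, and the limiting
  multiplier of the \<open>u2 k\<close> lies in \<open>Delta\<close>, so the second-order condition is violated.\<close>

lemma tilt_argmin_lipschitz: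
  assumes "0 < r" "r \<le> \<rho>" and xb: "xb \<in> feasible q"
    and strict: "\<And>x. x \<in> feasible q \<Longrightarrow> x \<in> cball xb r \<Longrightarrow> x \<noteq> xb \<Longrightarrow> g xb < g x"
  obtains \<kappa> \<delta> where "0 < \<kappa>" "0 < \<delta>"
    "\<And>v1 v2 u1 u2. norm v1 < \<delta> \<Longrightarrow> norm v2 < \<delta> \<Longrightarrow> u1 \<in> tilt_argmin g (feasible q) xb r v1 \<Longrightarrow>
       u2 \<in> tilt_argmin g (feasible q) xb r v2 \<Longrightarrow> dist u1 u2 \<le> \<kappa> * dist v1 v2"
proof (rule ccontr)
  assume contr: "\<not> thesis"
  note violated = that
  let ?A = "tilt_argmin g (feasible q) xb r"
  obtain \<delta> where \<delta>: "0 < \<delta>" "\<And>v u. norm v < \<delta> \<Longrightarrow> u \<in> ?A v \<Longrightarrow> dist xb u < r"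
    using tilt_argmin_near[OF \<open>0 < r\<close> xb strict \<open>0 < r\<close>] by blast
  define \<epsilon> where "\<epsilon> k = \<delta> / real (Suc k)" for k
  have \<epsilon>: "0 < \<epsilon> k" "\<epsilon> k \<le> \<delta>" for k
    using \<delta>(1) by (auto simp: \<epsilon>_def field_simps)
  have \<epsilon>0: "\<epsilon> \<longlonglongrightarrow> 0"
    unfolding \<epsilon>_def by real_asymp
  \<comment> \<open>Limits of multipliers lie in \<open>Delta\<close> only along points different from \<open>xb\<close>, so the two points
     are exchanged if the second one is \<open>xb\<close>.\<close>
  have "\<exists>v1 v2 u1 u2. norm v1 < \<epsilon> k \<and> norm v2 < \<epsilon> k \<and> u1 \<in> ?A v1 \<and> u2 \<in> ?A v2 \<and>
      real (Suc k) * dist v1 v2 < dist u1 u2 \<and> u2 \<noteq> xb" for k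
  proof -
    have "\<not> (\<forall>v1 v2 u1 u2. norm v1 < \<epsilon> k \<longrightarrow> norm v2 < \<epsilon> k \<longrightarrow> u1 \<in> ?A v1 \<longrightarrow> u2 \<in> ?A v2 \<longrightarrow>
        dist u1 u2 \<le> real (Suc k) * dist v1 v2)" (is "\<not> ?P")
    proof
      assume P: ?P
      have thesis
        by (rule violated[of "real (Suc k)" "\<epsilon> k"]) (use P \<epsilon>(1) in \<open>simp_all only: of_nat_0_less_iff zero_less_Suc\<close>)
      with contr show False by contradiction
    qed
    then obtain v1 v2 u1 u2 where *: "norm v1 < \<epsilon> k" "norm v2 < \<epsilon> k" "u1 \<in> ?A v1" "u2 \<in> ?A v2"
      "real (Suc k) * dist v1 v2 < dist u1 u2"
      by (auto simp only: not_all not_imp not_le)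
    have "0 \<le> real (Suc k) * dist v1 v2"
      by simp
    with *(5) have "0 < dist u1 u2"
      by linarith
    then have "u1 \<noteq> u2"
      by simp
    show ?thesis
    proof (cases "u2 = xb")
      case False
      with * show ?thesis by blast
    next
      case True
      with \<open>u1 \<noteq> u2\<close> have "u1 \<noteq> xb" by simp
      moreover have "real (Suc k) * dist v2 v1 < dist u2 u1"
        using *(5) by (simp only: dist_commute)
      ultimately show ?thesis
        using * by blast
    qed
  qed
  then obtain v1 v2 u1 u2 where v1: "\<And>k. norm (v1 k) < \<epsilon> k" and v2: "\<And>k. norm (v2 k) < \<epsilon> k"
    and u1: "\<And>k. u1 k \<in> ?A (v1 k)" and u2: "\<And>k. u2 k \<in> ?A (v2 k)"
    and far: "\<And>k. real (Suc k) * dist (v1 k) (v2 k) < dist (u1 k) (u2 k)" and ne: "\<And>k. u2 k \<noteq> xb"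
    by metis
  have v20: "v2 \<longlonglongrightarrow> 0"
    by (rule Lim_null_comparison[OF always_eventually \<epsilon>0]) (simp add: less_imp_le v2)
  have conv: "u \<longlonglongrightarrow> xb" if v: "\<And>k. norm (v k) < \<epsilon> k" and u: "\<And>k. u k \<in> ?A (v k)" for u v
  proof (rule tendstoI)
    fix e :: real assume "0 < e"
    then obtain \<eta> where \<eta>: "0 < \<eta>" "\<And>v u. norm v < \<eta> \<Longrightarrow> u \<in> ?A v \<Longrightarrow> dist xb u < e"
      using tilt_argmin_near[OF \<open>0 < r\<close> xb strict] by blast
    have "\<forall>\<^sub>F k in sequentially. \<epsilon> k < \<eta>"
      using \<epsilon>0 \<eta>(1) by (rule order_tendstoD)
    then show "\<forall>\<^sub>F k in sequentially. dist (u k) xb < e"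
    proof eventually_elim
      case (elim k)
      then show ?case
        using \<eta>(2)[OF less_trans[OF v elim] u] by (simp add: dist_commute)
    qed
  qed
  have "\<exists>l. kkt g q (v2 k) (u2 k) l \<and> norm l \<le> c * norm (grad g (u2 k) - v2 k)" for k
  proof (rule local_min_bounded_kkt[OF q, where W = "ball xb r" and f = "\<lambda>x. g x - v2 k \<bullet> x"])
    show "((\<lambda>x. g x - v2 k \<bullet> x) has_derivative (\<lambda>h. (grad g (u2 k) - v2 k) \<bullet> h)) (at (u2 k))"
      by (auto intro!: derivative_eq_intros twice_cont_diff_has_derivative[OF g]
          simp: fun_eq_iff inner_diff_left)
    show "u2 k \<in> ball xb r"
      using \<delta>(2)[OF _ u2] v2[of k] \<epsilon>(2)[of k] by auto
    show "u2 k \<in> feasible q"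
      using u2[of k] by (simp add: tilt_argmin_def is_arg_min_linorder)
    show "g (u2 k) - v2 k \<bullet> u2 k \<le> g p - v2 k \<bullet> p" if "p \<in> feasible q" "p \<in> ball xb r" for p
      using u2[of k] that by (auto simp: tilt_argmin_def is_arg_min_linorder)
  qed (use c \<open>r \<le> \<rho>\<close> subreg in auto)
  then obtain l where kkt: "\<And>k. kkt g q (v2 k) (u2 k) (l k)"
    and bound: "\<And>k. norm (l k) \<le> c * norm (grad g (u2 k) - v2 k)"
    by metis
  have u12: "u1 k \<noteq> u2 k" for k
  proof -
    have "0 \<le> real (Suc k) * dist (v1 k) (v2 k)"
      by simp
    with far[of k] have "0 < dist (u1 k) (u2 k)"
      by linarith
    then show ?thesis
      by simp
  qed
  obtain \<sigma> l' w where \<sigma>: "strict_mono \<sigma>" and l\<sigma>: "(\<lambda>k. l (\<sigma> k)) \<longlonglongrightarrow> l'" and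
    w: "(\<lambda>k. (u1 (\<sigma> k) - u2 (\<sigma> k)) /\<^sub>R norm (u1 (\<sigma> k) - u2 (\<sigma> k))) \<longlonglongrightarrow> w" "w \<noteq> 0"
    and l': "l' \<in> Delta g q \<gamma> xb"
    by (rule kkt_subsequence[OF kkt bound conv[OF v2 u2] v20 ne u12])
  have u1\<sigma>: "(\<lambda>k. u1 (\<sigma> k)) \<longlonglongrightarrow> xb" and u2\<sigma>: "(\<lambda>k. u2 (\<sigma> k)) \<longlonglongrightarrow> xb"
    using LIMSEQ_subseq_LIMSEQ[OF conv[OF v1 u1] \<sigma>] LIMSEQ_subseq_LIMSEQ[OF conv[OF v2 u2] \<sigma>]
    by (simp_all add: o_def)
  have e0: "(\<lambda>k. inverse (real (Suc (\<sigma> k)))) \<longlonglongrightarrow> 0"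
    using LIMSEQ_subseq_LIMSEQ[OF LIMSEQ_inverse_real_of_nat \<sigma>] by (simp add: o_def)
  have "g (u1 k) - g (u2 k) - v2 k \<bullet> (u1 k - u2 k) \<le> inverse (real (Suc k)) * (norm (u1 k - u2 k))\<^sup>2" for k
  proof -
    have "g (u1 k) - v1 k \<bullet> u1 k \<le> g (u2 k) - v1 k \<bullet> u2 k"
      using u1[of k] u2[of k] by (auto simp: tilt_argmin_def is_arg_min_linorder)
    then have "g (u1 k) - g (u2 k) - v2 k \<bullet> (u1 k - u2 k) \<le> (v1 k - v2 k) \<bullet> (u1 k - u2 k)"
      by (simp add: inner_diff_left inner_diff_right)
    also have "\<dots> \<le> norm (v1 k - v2 k) * norm (u1 k - u2 k)"
      by (rule norm_cauchy_schwarz)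
    also have "norm (v1 k - v2 k) \<le> inverse (real (Suc k)) * norm (u1 k - u2 k)"
      using far[of k] by (simp add: dist_norm field_simps)
    finally show ?thesis
      by (simp add: power2_eq_square mult_right_mono mult.assoc)
  qed
  note tp = two_point_second_order[OF g q kkt _ u2\<sigma> u1\<sigma> l\<sigma> not_sym[OF u12] w(1) e0 this]
  have feas: "u1 (\<sigma> k) \<in> feasible q" for k
    using u1[of "\<sigma> k"] by (simp add: tilt_argmin_def is_arg_min_linorder)
  have "w \<bullet> (hess (\<lambda>x. lagrangian g q x l') xb *v w) > 0"
    using w(2) l' tp(2)[OF feas] by (intro soc) auto
  with tp(1)[OF feas] show False
    by simp
qed

lemma tilt_stable_feasible:
  assumes "\<rho> > 0" and kkt0: "kkt g q 0 xb l0"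
  shows "tilt_stable g (feasible q) xb"
proof -
  have xb: "xb \<in> feasible q"
    using kkt0 by (simp add: kkt_def)
  obtain r where r: "0 < r" "r \<le> \<rho>"
    and strict: "\<And>x. x \<in> feasible q \<Longrightarrow> x \<in> cball xb r \<Longrightarrow> x \<noteq> xb \<Longrightarrow> g xb < g x"
    using strict_local_minimizer[OF assms] by blast
  let ?A = "tilt_argmin g (feasible q) xb r"
  obtain \<kappa> \<delta> where \<kappa>: "0 < \<kappa>" and \<delta>: "0 < \<delta>"
    and lip: "\<And>v1 v2 u1 u2. norm v1 < \<delta> \<Longrightarrow> norm v2 < \<delta> \<Longrightarrow> u1 \<in> ?A v1 \<Longrightarrow> u2 \<in> ?A v2 \<Longrightarrow>
       dist u1 u2 \<le> \<kappa> * dist v1 v2"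
    using tilt_argmin_lipschitz[OF r xb strict] by blast
  define s where "s v = (SOME u. u \<in> ?A v)" for v
  have s: "s v \<in> ?A v" for v
  proof -
    have "compact (feasible q \<inter> cball xb r)"
      by (intro closed_Int_compact closed_feasible q compact_cball)
    moreover have "xb \<in> feasible q \<inter> cball xb r"
      using xb r by auto
    moreover have "continuous_on A (\<lambda>x. g x - v \<bullet> x)" for A
      using twice_cont_diff_isCont[OF g]
      by (intro continuous_intros continuous_at_imp_continuous_on) auto
    ultimately have "\<exists>u\<in>feasible q \<inter> cball xb r. \<forall>p\<in>feasible q \<inter> cball xb r. g u - v \<bullet> u \<le> g p - v \<bullet> p"
      by (intro continuous_attains_inf) auto
    then have "\<exists>u. u \<in> ?A v"
      by (auto simp: tilt_argmin_def is_arg_min_linorder)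
    then show ?thesis
      unfolding s_def by (rule someI_ex)
  qed
  have "?A v = {s v}" if "v \<in> ball 0 \<delta>" for v
    using lip[of v v] s that by fastforce
  moreover have "\<kappa>-lipschitz_on (ball 0 \<delta>) s"
    using \<kappa> by (intro lipschitz_onI lip s) auto
  moreover have "xb \<in> ?A 0"
    using strict xb r by (auto simp: tilt_argmin_def is_arg_min_linorder) (metis less_imp_le order_refl mem_cball)
  with lip[of 0 0, OF _ _ s this] \<delta> have "s 0 = xb"
    by simp
  ultimately have "tilt_stable_with g (feasible q) xb \<kappa>"
    unfolding tilt_stable_with_def using xb \<kappa> r(1) \<delta>
    by (auto intro!: exI[of _ r] exI[of _ "ball 0 \<delta>"] exI[of _ s])
  then show ?thesis
    unfolding tilt_stable_def by blast
qed

end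

theorem theorem4p11:
  fixes g :: "real^'n \<Rightarrow> real" and q :: "real^'n \<Rightarrow> real^'m"
    and xb :: "real^'n" and \<gamma> :: real
  assumes "twice_cont_diff g"
    and "\<And>i. twice_cont_diff (\<lambda>x. q x $ i)"
    and "stationary g q xb"
    and "\<gamma> > 0"
    and "MSCQ q xb"
    and "ereal \<gamma> > subreg q xb"
    and "\<And>w l. w \<noteq> 0 \<Longrightarrow> l \<in> Delta g q \<gamma> xb \<Longrightarrow>
           (\<And>i. i \<in> pos_idx l \<Longrightarrow> grad (\<lambda>x. q x $ i) xb \<bullet> w = 0) \<Longrightarrow>
           w \<bullet> (hess (\<lambda>x. lagrangian g q x l) xb *v w) > 0"
  shows "tilt_stable g (feasible q) xb"
proof -
  obtain c where c: "subreg_const q xb c" "c < \<gamma>"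
    using assms(6) by (auto simp: subreg_def Inf_less_iff)
  then obtain U where "open U" "xb \<in> U" and U: "\<And>y. y \<in> U \<Longrightarrow>
      infdist y (feasible q) \<le> c * infdist (q y) nonpos_orthant" and "c > 0"
    by (auto simp: subreg_const_def)
  then obtain \<rho> where \<rho>: "\<rho> > 0" "ball xb \<rho> \<subseteq> U"
    using open_contains_ball by blast
  obtain l0 where "kkt g q 0 xb l0"
    using assms(3) by (auto simp: stationary_def kkt_def grad_lagrangian[OF assms(1,2)])
  then show ?thesis
    using \<rho> U c(2) \<open>c > 0\<close>
    by (intro tilt_stable_feasible[OF assms(1,2) _ _ _ assms(7), where c = c and \<rho> = \<rho>]) auto
qed

end
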